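(* Let $q$ be a prime of the form $3k+1$ and write $4q=L^2+27M^2$ with $L,M\in\mathbb{Z}$ and $L\equiv 1\pmod 3$. Let $p$ be a prime with $p\neq 2,3,q$ and $p\nmid L$. Then $$\sum_{k=1}^{[p/3]}\binom{3k}{k}\frac{M^{2k}}{q^k}\equiv\begin{cases}0\pmod p&\text{if }p^{\frac{q-1}{3}}\equiv 1\pmod q,\\[1mm]\frac{-3-9M/L}{2}\pmod p&\text{if }p^{\frac{q-1}{3}}\equiv\frac{-1+9M/L}{2}\pmod q,\\[1mm]\frac{-3+9M/L}{2}\pmod p&\text{if }p^{\frac{q-1}{3}}\equiv\frac{-1-9M/L}{2}\pmod q.\end{cases}$$
   Context: $[x]$ is the greatest integer not exceeding $x$. Congruences modulo a prime $\ell$ between rational numbers are taken in the ring of rational numbers whose denominator is not divisible by $\ell$. *)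

theory Defs
  imports "HOL-Number_Theory.Number_Theory"
begin

text \<open>
  The library congruence is of no use here: in the field of rationals every congruence
  modulo a nonzero number holds. Congruences between rationals are therefore taken in the
  subring of rationals whose reduced denominator is not divisible by \<open>l\<close>; both sides
  are required to lie in that subring.
\<close>

definition local_ring :: "nat \<Rightarrow> rat set" where
  "local_ring l = {x. \<not> int l dvd snd (quotient_of x)}"

definition rat_cong :: "rat \<Rightarrow> rat \<Rightarrow> nat \<Rightarrow> bool" where
  "rat_cong a b l \<longleftrightarrow>
     a \<in> local_ring l \<and> b \<in> local_ring l \<and> (\<exists>c \<in> local_ring l. a - b = of_nat l * c)"

end

theory Submission
  imports Defs "HOL-Computational_Algebra.Polynomial"
begin

text \<open>
  Let \<open>n = [p/3]\<close>. Modulo \<open>p\<close> one has \<open>binom(3k,k) \<equiv> (-27)^k binom(n+k,2k)\<close> for \<open>k \<le> n\<close>. Put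
  \<open>J = (L + 3M sqrt(-3))/2\<close> in the Eisenstein integers, with conjugate \<open>J'\<close>, so that \<open>J J' = q\<close>,
  \<open>J + J' = L\<close> and \<open>(J - J')^2 = -27 M^2\<close>. The identity
  \<open>(x + y) \<Sum> binom(n+k,2k) (x-y)^(2k) (xy)^(n-k) = x^(2n+1) + y^(2n+1)\<close> then gives
  \<open>L q^n (S + 1) \<equiv> J^(2n+1) + J'^(2n+1)\<close>.

  Now \<open>J\<close> is the Jacobi sum of the cubic residue character \<open>\<chi>\<close> modulo \<open>q\<close>. Raising the Gauss sum
  \<open>G\<close> to the power \<open>p\<close> once by \<open>G^3 = q J\<close> and once by the Frobenius congruence shows that
  \<open>J^(2n+1)\<close> is congruent to \<open>q^n \<chi>(p) J\<close> or to its conjugate. Hence \<open>L (S + 1)\<close> is congruent to the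
  trace of \<open>\<chi>(p) J\<close>, and the three cases are \<open>\<chi>(p) = 1, \<omega>, \<omega>\<^sup>2\<close>. Gauss sums live in the group ring
  of the integers modulo \<open>q\<close> rather than in a cyclotomic field, so that a congruence
  can be read off from a single coefficient.
\<close>

subsection \<open>Binomial coefficients\<close>

text \<open>
  The two identities are proved together: Pascal's rule expresses each sum at \<open>n + 1\<close> through both.
\<close>

lemma binomial_odd_power_sum:
  fixes x y :: "'a :: comm_ring_1"
  shows "(x + y) * (\<Sum>k\<le>n. of_nat ((n + k) choose (2 * k)) * (x - y) ^ (2 * k) * (x * y) ^ (n - k))
           = x ^ (2 * n + 1) + y ^ (2 * n + 1)" (is "(x + y) * ?A n = ?a n")
    and "(x ^ 2 - y ^ 2) * (\<Sum>k\<le>n. of_nat ((n + k + 1) choose (2 * k + 1)) * (x - y) ^ (2 * k) * (x * y) ^ (n - k))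
           = x ^ (2 * n + 2) - y ^ (2 * n + 2)" (is "_ * ?E n = ?e n")
proof (induction n)
  case (Suc n)
  have A: "?A (Suc n) = x * y * ?A n + (x - y) ^ 2 * ?E n"
  proof -
    \<comment> \<open>The guard at \<open>k = 0\<close> matters: there \<open>2 * k - 1\<close>
      truncates to 0 and would contribute a spurious binomial coefficient 1.\<close>
    have "?A (Suc n) = (\<Sum>k\<le>Suc n. of_nat ((n + k) choose (2 * k)) * (x - y) ^ (2 * k) * (x * y) ^ (Suc n - k)
        + (if k = 0 then 0 else of_nat ((n + k) choose (2 * k - 1)) * (x - y) ^ (2 * k) * (x * y) ^ (Suc n - k)))"
    proof (intro sum.cong refl, goal_cases)
      case (1 k)
      then show ?case by (cases k) (simp_all add: algebra_simps)
    qed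
    also have "\<dots> = (\<Sum>k\<le>Suc n. of_nat ((n + k) choose (2 * k)) * (x - y) ^ (2 * k) * (x * y) ^ (Suc n - k))
        + (\<Sum>k\<le>Suc n. if k = 0 then 0 else of_nat ((n + k) choose (2 * k - 1)) * (x - y) ^ (2 * k) * (x * y) ^ (Suc n - k))"
      by (rule sum.distrib)
    also have "(\<Sum>k\<le>Suc n. of_nat ((n + k) choose (2 * k)) * (x - y) ^ (2 * k) * (x * y) ^ (Suc n - k)) = x * y * ?A n"
      by (simp add: sum_distrib_left Suc_diff_le mult_ac binomial_eq_0)
    also have "(\<Sum>k\<le>Suc n. if k = 0 then 0 else of_nat ((n + k) choose (2 * k - 1)) * (x - y) ^ (2 * k) * (x * y) ^ (Suc n - k))
        = (x - y) ^ 2 * ?E n"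
      by (subst sum.atMost_Suc_shift) (simp add: sum_distrib_left mult_ac power2_eq_square)
    finally show ?thesis .
  qed
  have E: "?E (Suc n) = ?A (Suc n) + x * y * ?E n"
  proof -
    have "?E (Suc n) = (\<Sum>k\<le>Suc n. of_nat ((Suc n + k) choose (2 * k)) * (x - y) ^ (2 * k) * (x * y) ^ (Suc n - k)
        + of_nat ((n + k + 1) choose (2 * k + 1)) * (x - y) ^ (2 * k) * (x * y) ^ (Suc n - k))"
      by (intro sum.cong refl) (simp add: algebra_simps)
    also have "\<dots> = ?A (Suc n) + (\<Sum>k\<le>Suc n. of_nat ((n + k + 1) choose (2 * k + 1)) * (x - y) ^ (2 * k) * (x * y) ^ (Suc n - k))"
      by (rule sum.distrib)
    also have "(\<Sum>k\<le>Suc n. of_nat ((n + k + 1) choose (2 * k + 1)) * (x - y) ^ (2 * k) * (x * y) ^ (Suc n - k)) = x * y * ?E n"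
      by (simp add: sum_distrib_left Suc_diff_le mult_ac binomial_eq_0)
    finally show ?thesis .
  qed
  have 1: "(x + y) * ?A (Suc n) = ?a (Suc n)"
  proof -
    have "(x + y) * ?A (Suc n) = x * y * ((x + y) * ?A n) + (x - y) * ((x ^ 2 - y ^ 2) * ?E n)"
      unfolding A by (simp add: algebra_simps power2_eq_square)
    also have "\<dots> = ?a (Suc n)"
      unfolding Suc.IH by (simp add: algebra_simps)
    finally show ?thesis .
  qed
  have 2: "(x ^ 2 - y ^ 2) * ?E (Suc n) = ?e (Suc n)"
  proof -
    have "(x ^ 2 - y ^ 2) * ?E (Suc n) = (x - y) * ((x + y) * ?A (Suc n)) + x * y * ((x ^ 2 - y ^ 2) * ?E n)"
      unfolding E by (simp add: algebra_simps power2_eq_square)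
    also have "\<dots> = ?e (Suc n)"
      unfolding Suc.IH 1 by (simp add: algebra_simps)
    finally show ?thesis .
  qed
  show "(x + y) * ?A (Suc n) = ?a (Suc n)" "(x ^ 2 - y ^ 2) * ?E (Suc n) = ?e (Suc n)"
    by (fact 1 2)+
qed (simp_all add: power2_eq_square)

text \<open>
  The factor \<open>fact (2 * k) * fact k\<close> clears the denominators of the hypergeometric terms behind
  both binomial coefficients. With \<open>3 * n = - 1\<close> or \<open>3 * n = - 2\<close> modulo \<open>p\<close>, the quotient
  of consecutive terms is the same in both cases.
\<close>

lemma choose_cong_aux:
  assumes "p = 3 * n + 1 \<or> p = 3 * n + 2" and "k \<le> n"
  shows "[27 ^ k * int ((n + k) choose (2 * k)) * fact (2 * k) * fact k = (-1) ^ k * fact (3 * k)] (mod int p)"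
  using assms(2)
proof (induction k)
  case (Suc k)
  have ch: "int ((n + Suc k) choose (2 * Suc k)) * fact (2 * Suc k)
      = int ((n + k) choose (2 * k)) * fact (2 * k) * (int (n + k + 1) * int (n - k))"
  proof -
    have "fact (2 * Suc k) * fact (n - Suc k) * ((n + Suc k) choose (2 * Suc k)) = (fact (n + Suc k) :: nat)"
      using binomial_fact_lemma[of "2 * Suc k" "n + Suc k"] Suc.prems by simp
    moreover have "fact (2 * k) * fact (n - k) * ((n + k) choose (2 * k)) = (fact (n + k) :: nat)"
      using binomial_fact_lemma[of "2 * k" "n + k"] Suc.prems by (simp add: mult_2)
    moreover have "fact (n - k) = (n - k) * (fact (n - Suc k) :: nat)"
      using Suc.prems by (metis Suc_diff_Suc Suc_le_lessD fact_Suc of_nat_id)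
    moreover have "fact (n + Suc k) = (n + k + 1) * (fact (n + k) :: nat)"
      by simp
    ultimately have "fact (2 * Suc k) * fact (n - Suc k) * ((n + Suc k) choose (2 * Suc k))
        = (n + k + 1) * (fact (2 * k) * ((n - k) * fact (n - Suc k)) * ((n + k) choose (2 * k)))"
      by metis
    hence "fact (n - Suc k) * (((n + Suc k) choose (2 * Suc k)) * fact (2 * Suc k))
        = fact (n - Suc k) * (((n + k) choose (2 * k)) * fact (2 * k) * ((n + k + 1) * (n - k)))"
      by (simp only: mult_ac)
    hence "((n + Suc k) choose (2 * Suc k)) * fact (2 * Suc k)
        = ((n + k) choose (2 * k)) * fact (2 * k) * ((n + k + 1) * (n - k))"
      by (metis fact_nonzero mult_cancel_left)
    thus ?thesis by (metis of_nat_fact of_nat_mult)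
  qed
  \<comment> \<open>The difference of the two sides is \<open>(3 * n + 1) * (3 * n + 2)\<close>,
    which does not involve \<open>k\<close> and has \<open>p\<close> as one of its factors.\<close>
  have pr: "[9 * (int (n + k + 1) * int (n - k)) = - ((3 * int k + 1) * (3 * int k + 2))] (mod int p)"
  proof -
    have "9 * (int (n + k + 1) * int (n - k)) + ((3 * int k + 1) * (3 * int k + 2)) = (3 * int n + 1) * (3 * int n + 2)"
      using Suc.prems by (simp add: of_nat_diff algebra_simps)
    moreover have "int p dvd (3 * int n + 1) * (3 * int n + 2)"
      using assms(1) by (elim disjE) (simp_all add: add_ac)
    ultimately show ?thesis by (simp add: cong_iff_dvd_diff)
  qed
  have "27 ^ Suc k * int ((n + Suc k) choose (2 * Suc k)) * fact (2 * Suc k) * fact (Suc k)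
     = 27 ^ k * 27 * (int ((n + Suc k) choose (2 * Suc k)) * fact (2 * Suc k)) * (fact k * (int k + 1))"
    by (simp only: power_Suc fact_Suc of_nat_Suc mult_ac add.commute)
  also have "\<dots> = (27 ^ k * int ((n + k) choose (2 * k)) * fact (2 * k) * fact k)
        * (9 * (int (n + k + 1) * int (n - k)) * (3 * int k + 3))"
    unfolding ch by (simp add: field_simps)
  also have "[\<dots> = ((-1) ^ k * fact (3 * k)) * (- ((3 * int k + 1) * (3 * int k + 2)) * (3 * int k + 3))] (mod int p)"
    using Suc.prems by (intro cong_mult cong_refl pr Suc.IH) simp
  also have "((-1) ^ k * fact (3 * k)) * (- ((3 * int k + 1) * (3 * int k + 2)) * (3 * int k + 3))
      = (-1) ^ Suc k * fact (3 * Suc k)"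
  proof -
    have "3 * Suc k = Suc (Suc (Suc (3 * k)))" by simp
    hence "(fact (3 * Suc k) :: int) = (3 * int k + 3) * ((3 * int k + 2) * ((3 * int k + 1) * fact (3 * k)))"
      by (simp only: fact_Suc) (simp add: add_ac)
    thus ?thesis by simp
  qed
  finally show ?case .
qed simp

text \<open>Since \<open>2 * k < p\<close>, the factor \<open>fact (2 * k) * fact k\<close> is prime
  to \<open>p\<close> and can be cancelled from \<open>choose_cong_aux\<close>.\<close>

lemma choose_cong:
  assumes "prime p" "p \<noteq> 3" "k \<le> p div 3"
  shows "[int ((3 * k) choose k) = (-27) ^ k * int ((p div 3 + k) choose (2 * k))] (mod int p)"
proof -
  define n where "n = p div 3"
  have "\<not> 3 dvd p" using assms(1,2) by (metis prime_nat_iff num.distinct(3) one_eq_numeral_iff)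
  hence p: "p = 3 * n + 1 \<or> p = 3 * n + 2" unfolding n_def by presburger
  have "coprime (fact (2 * k) * fact k) (int p)"
  proof -
    have "coprime (fact m) p" if "m < p" for m
      using assms(1) that by (metis coprime_commute prime_dvd_fact_iff leD prime_imp_coprime)
    moreover have "2 * k < p" "k < p" using assms(3) p n_def prime_gt_0_nat[OF assms(1)] by linarith+
    ultimately have "coprime (fact (2 * k) * fact k) p" by simp
    thus ?thesis by (metis coprime_int_iff of_nat_fact of_nat_mult)
  qed
  moreover have "[int ((3 * k) choose k) * (fact (2 * k) * fact k)
      = (-27) ^ k * int ((n + k) choose (2 * k)) * (fact (2 * k) * fact k)] (mod int p)"
  proof -
    have "fact k * fact (2 * k) * ((3 * k) choose k) = (fact (3 * k) :: nat)"
      using binomial_fact_lemma[of k "3 * k"] by (simp add: mult_2)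
    hence "fact (3 * k) = int ((3 * k) choose k) * (fact (2 * k) * fact k)"
      by (metis mult.commute of_nat_fact of_nat_mult)
    moreover have "(-27 :: int) ^ k = (-1) ^ k * 27 ^ k" by (metis mult_minus1 power_mult_distrib)
    moreover have "(-1 :: int) ^ k * ((-1) ^ k * x) = x" for x
      by (simp flip: mult.assoc power_mult_distrib)
    ultimately have 1: "int ((3 * k) choose k) * (fact (2 * k) * fact k) = (-1) ^ k * ((-1) ^ k * fact (3 * k))"
        and 2: "(-27) ^ k * int ((n + k) choose (2 * k)) * (fact (2 * k) * fact k)
           = (-1) ^ k * (27 ^ k * int ((n + k) choose (2 * k)) * fact (2 * k) * fact k)"
      by (simp_all add: mult.assoc)
    show ?thesis unfolding 1 2
      by (intro cong_mult cong_refl cong_sym[OF choose_cong_aux[OF p assms(3)[folded n_def]]])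
  qed
  ultimately show ?thesis unfolding n_def by (simp add: cong_mult_rcancel)
qed

subsection \<open>Eisenstein integers\<close>

text \<open>\<open>Eis a b\<close> stands for \<open>a + b * omega\<close> with \<open>omega\<close>
  a primitive cube root of unity; the product below reduces by
  \<open>omega ^ 2 = - 1 - omega\<close>.\<close>

datatype eisenstein = Eis (re_part: int) (om_part: int)

instantiation eisenstein :: comm_ring_1
begin

definition "0 = Eis 0 0"
definition "1 = Eis 1 0"
definition "x + y = Eis (re_part x + re_part y) (om_part x + om_part y)"
definition "x - y = Eis (re_part x - re_part y) (om_part x - om_part y)"
definition "- x = Eis (- re_part x) (- om_part x)"
definition "x * y = Eis (re_part x * re_part y - om_part x * om_part y)
  (re_part x * om_part y + om_part x * re_part y - om_part x * om_part y)"

instance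
  by standard
    (simp_all add: zero_eisenstein_def one_eisenstein_def plus_eisenstein_def
      minus_eisenstein_def uminus_eisenstein_def times_eisenstein_def algebra_simps)

end

lemma eisenstein_simps [simp]:
  "re_part 0 = 0" "om_part 0 = 0" "re_part 1 = 1" "om_part 1 = 0"
  "re_part (x + y) = re_part x + re_part y" "om_part (x + y) = om_part x + om_part y"
  "re_part (x - y) = re_part x - re_part y" "om_part (x - y) = om_part x - om_part y"
  "re_part (- x) = - re_part x" "om_part (- x) = - om_part x"
  "re_part (x * y) = re_part x * re_part y - om_part x * om_part y"
  "om_part (x * y) = re_part x * om_part y + om_part x * re_part y - om_part x * om_part y"
  by (simp_all add: zero_eisenstein_def one_eisenstein_def plus_eisenstein_def
      minus_eisenstein_def uminus_eisenstein_def times_eisenstein_def)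

lemma eisenstein_of_nat [simp]: "re_part (of_nat n) = int n" "om_part (of_nat n) = 0"
  by (induction n) simp_all

lemma eisenstein_of_int [simp]: "re_part (of_int a) = a" "om_part (of_int a) = 0"
  by (cases a rule: int_cases; simp)+

lemma eisenstein_numeral [simp]: "re_part (numeral n) = numeral n" "om_part (numeral n) = 0"
  using eisenstein_of_nat[of "numeral n"] by simp_all

lemma eisenstein_of_nat_dvd_iff:
  "of_nat n dvd z \<longleftrightarrow> int n dvd re_part z \<and> int n dvd om_part z"
proof
  assume "int n dvd re_part z \<and> int n dvd om_part z"
  then obtain a b where "re_part z = int n * a" "om_part z = int n * b" by (auto simp: dvd_def)
  hence "z = of_nat n * Eis a b" by (intro eisenstein.expand) simp
  thus "of_nat n dvd z" by simp
qed (auto simp: dvd_def)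

definition omega :: eisenstein where "omega = Eis 0 1"

lemma omega_parts [simp]: "re_part omega = 0" "om_part omega = 1"
  by (simp_all add: omega_def)

lemma omega_cube: "omega ^ 3 = 1"
  by (rule eisenstein.expand) (simp add: power3_eq_cube)

text \<open>Complex conjugation: it sends \<open>omega\<close> to \<open>omega ^ 2\<close>, that is,
  to \<open>- 1 - omega\<close>.\<close>

definition eis_cnj :: "eisenstein \<Rightarrow> eisenstein" where
  "eis_cnj z = Eis (re_part z - om_part z) (- om_part z)"

lemma eis_cnj_simps [simp]:
  "eis_cnj 0 = 0" "eis_cnj 1 = 1"
  "eis_cnj (x + y) = eis_cnj x + eis_cnj y" "eis_cnj (x - y) = eis_cnj x - eis_cnj y"
  "eis_cnj (x * y) = eis_cnj x * eis_cnj y"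
  "eis_cnj (of_nat n) = of_nat n"
  by (auto intro!: eisenstein.expand simp: eis_cnj_def algebra_simps)

lemma eis_cnj_power [simp]: "eis_cnj (x ^ n) = eis_cnj x ^ n"
  by (induction n) simp_all

lemma eis_cnj_sum: "eis_cnj (sum f A) = (\<Sum>a\<in>A. eis_cnj (f a))"
  by (induction A rule: infinite_finite_induct) simp_all

definition eis_trace :: "eisenstein \<Rightarrow> int" where
  "eis_trace z = 2 * re_part z - om_part z"

lemma of_int_eis_trace: "of_int (eis_trace z) = z + eis_cnj z"
  by (rule eisenstein.expand) (simp add: eis_trace_def eis_cnj_def)

subsection \<open>The group ring of the integers modulo \<open>q\<close>\<close>

text \<open>
  \<open>pcong c q\<close> is congruence modulo the ideal generated by \<open>c\<close> and \<open>x ^ q - 1\<close>, that is,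
  congruence modulo \<open>c\<close> in the group ring of the integers modulo \<open>q\<close>; exact identities in the
  group ring are the case \<open>c = 0\<close>.
\<close>

definition pcong :: "'a :: comm_ring_1 \<Rightarrow> nat \<Rightarrow> 'a poly \<Rightarrow> 'a poly \<Rightarrow> bool" where
  "pcong c q f g \<longleftrightarrow> (\<exists>u v. f - g = smult c u + (monom 1 q - 1) * v)"

lemma pcong_refl [simp, intro]: "pcong c q f f"
  unfolding pcong_def by (intro exI[of _ 0]) simp

lemma pcong_add: "pcong c q f g \<Longrightarrow> pcong c q f' g' \<Longrightarrow> pcong c q (f + f') (g + g')"
  unfolding pcong_def
proof (elim exE)
  fix u v u' v' assume "f - g = smult c u + (monom 1 q - 1) * v" "f' - g' = smult c u' + (monom 1 q - 1) * v'"
  hence "f + f' - (g + g') = smult c (u + u') + (monom 1 q - 1) * (v + v')"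
    by (simp add: add_diff_add smult_add_right distrib_left)
  thus "\<exists>u v. f + f' - (g + g') = smult c u + (monom 1 q - 1) * v" by blast
qed

lemma pcong_sum: "(\<And>i. i \<in> A \<Longrightarrow> pcong c q (f i) (g i)) \<Longrightarrow> pcong c q (sum f A) (sum g A)"
  by (induction A rule: infinite_finite_induct) (auto intro: pcong_add)

lemma pcong_mult_left: "pcong c q f g \<Longrightarrow> pcong c q (h * f) (h * g)"
  unfolding pcong_def
proof (elim exE)
  fix u v assume "f - g = smult c u + (monom 1 q - 1) * v"
  hence "h * f - h * g = smult c (h * u) + (monom 1 q - 1) * (h * v)"
    by (metis (no_types, lifting) distrib_left mult.left_commute mult_smult_right right_diff_distrib)
  thus "\<exists>u v. h * f - h * g = smult c u + (monom 1 q - 1) * v" by blast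
qed

lemma pcong_sym: "pcong c q f g \<Longrightarrow> pcong c q g f"
  unfolding pcong_def
proof (elim exE)
  fix u v assume "f - g = smult c u + (monom 1 q - 1) * v"
  hence "g - f = smult c (- u) + (monom 1 q - 1) * (- v)"
    by (metis minus_add_distrib minus_diff_eq mult_minus_right smult_minus_right)
  thus "\<exists>u v. g - f = smult c u + (monom 1 q - 1) * v" by blast
qed

lemma pcong_trans [trans]: 
  assumes "pcong c q f g" "pcong c q g h" 
  shows "pcong c q f h"
proof -
  have "pcong c q (f + g) (g + h)" by (rule pcong_add) fact+
  thus ?thesis by (simp add: pcong_def)
qed

lemma pcong_mult:
  assumes "pcong c q f g" "pcong c q f' g'"
  shows "pcong c q (f * f') (g * g')"
  using pcong_trans[OF pcong_mult_left[OF assms(2)] pcong_mult_left[OF assms(1), of g', simplified mult.commute[of g']]] 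
  by simp

text \<open>Adding up the coefficients at \<open>r\<close>, \<open>r + q\<close>,
  \<open>r + 2 * q\<close> and so on annihilates multiples of \<open>x ^ q - 1\<close>; for a
  polynomial of degree below \<open>q\<close> it returns the coefficient at
  \<open>r\<close>.\<close>

lemma pcong_coeff:
  assumes "pcong c q f g" and "degree f < q" "degree g < q" "r < q"
  shows "c dvd coeff f r - coeff g r"
proof -
  obtain u v where uv: "f - g = smult c u + (monom 1 q - 1) * v"
    using assms(1) by (auto simp: pcong_def)
  define B where "B = Suc (degree v)"
  \<comment> \<open>The sum telescopes. For \<open>n = Suc B\<close> what remains is, up to sign, a
    coefficient of \<open>v\<close> beyond its degree.\<close>
  have *: "(\<Sum>i<n. coeff ((monom 1 q - 1) * v) (r + q * i)) = (if n = 0 then 0 else - coeff v (r + q * (n - 1)))" for n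
  proof (induction n)
    case (Suc n)
    have "coeff ((monom 1 q - 1) * v) (r + q * n)
        = (if n = 0 then 0 else coeff v (r + q * (n - 1))) - coeff v (r + q * n)"
      using assms(4) by (cases n) (simp_all add: left_diff_distrib coeff_monom_mult)
    with Suc show ?case by simp
  qed simp
  have "(\<Sum>i<Suc B. coeff (f - g) (r + q * i)) = coeff (f - g) r + (\<Sum>i<B. coeff (f - g) (r + q * Suc i))"
    by (subst sum.lessThan_Suc_shift) simp
  also have "(\<Sum>i<B. coeff (f - g) (r + q * Suc i)) = 0"
    using assms(2,3) by (intro sum.neutral) (auto simp: coeff_eq_0)
  finally have "coeff f r - coeff g r = (\<Sum>i<Suc B. coeff (f - g) (r + q * i))" by simp
  also have "\<dots> = (\<Sum>i<Suc B. coeff (smult c u) (r + q * i)) + (\<Sum>i<Suc B. coeff ((monom 1 q - 1) * v) (r + q * i))"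
    unfolding uv by (simp add: sum.distrib)
  also have "(\<Sum>i<Suc B. coeff ((monom 1 q - 1) * v) (r + q * i)) = - coeff v (r + q * B)"
    unfolding * by simp
  also have "coeff v (r + q * B) = 0"
  proof (rule coeff_eq_0)
    have "degree v < B" by (simp add: B_def)
    also have "B \<le> q * B" using assms(4) by simp
    finally show "degree v < r + q * B" by simp
  qed
  also have "(\<Sum>i<Suc B. coeff (smult c u) (r + q * i)) = c * (\<Sum>i<Suc B. coeff u (r + q * i))"
    by (simp only: coeff_smult sum_distrib_left)
  finally show ?thesis by simp
qed

lemma pcong_monom_add: "pcong c q (monom a (n + q)) (monom a n)"
proof -
  have "monom a (n + q) - monom a n = (monom 1 q - 1) * monom a n"
    by (simp add: left_diff_distrib mult_monom add.commute)
  thus ?thesis unfolding pcong_def by (metis add_0 smult_0_right)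
qed

lemma pcong_monom_mod: "pcong c q (monom a n) (monom a (n mod q))"
proof (induction n rule: less_induct)
  case (less n)
  show ?case
  proof (cases "q = 0 \<or> n < q")
    case False
    hence "pcong c q (monom a n) (monom a (n - q))"
      using pcong_monom_add[of c q a "n - q"] by simp
    also have "pcong c q (monom a (n - q)) (monom a ((n - q) mod q))"
      using False by (intro less) auto
    finally show ?thesis using False by (simp add: le_mod_geq)
  qed auto
qed

text \<open>The map from \<open>a\<close> to \<open>e * a + d\<close> permutes the residues modulo
  \<open>q\<close>. The changes of variable below come from this.\<close>

lemma sum_periodic_affine:
  fixes q :: int
  assumes "q > 0" "coprime e q" and per: "\<And>a. F (a mod q) = F a"
  shows "(\<Sum>a\<in>{0..<q}. F (e * a + d)) = (\<Sum>a\<in>{0..<q}. F a)"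
proof -
  let ?h = "\<lambda>a. (e * a + d) mod q"
  have "inj_on ?h {0..<q}"
  proof (rule inj_onI)
    fix a b assume ab: "a \<in> {0..<q}" "b \<in> {0..<q}" "?h a = ?h b"
    hence "[e * a + d = e * b + d] (mod q)" by (simp add: cong_def)
    hence "[a = b] (mod q)" using assms(2) by (simp add: cong_add_rcancel cong_mult_lcancel)
    thus "a = b" using ab by (simp add: cong_def)
  qed
  moreover have "?h ` {0..<q} \<subseteq> {0..<q}" using assms(1) by auto
  ultimately have "bij_betw ?h {0..<q} {0..<q}"
    by (simp add: bij_betw_def endo_inj_surj)
  hence "(\<Sum>a\<in>{0..<q}. F a) = (\<Sum>a\<in>{0..<q}. F (?h a))"
    by (rule sum.reindex_bij_betw[symmetric])
  thus ?thesis by (simp add: per)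
qed

text \<open>The inner binomial coefficients \<open>p choose k\<close> are divisible by
  \<open>p\<close>. The ring is left general because the application is to polynomials.\<close>

lemma prime_dvd_power_add_diff:
  fixes a b :: "'a :: comm_ring_1"
  assumes "prime p"
  shows "of_nat p dvd (a + b) ^ p - (a ^ p + b ^ p)"
proof -
  have p: "p > 0" using assms by (rule prime_gt_0_nat)
  have "(a + b) ^ p = (\<Sum>k\<le>p. of_nat (p choose k) * a ^ k * b ^ (p - k))"
    by (rule binomial_ring)
  also have "{..p} = insert 0 (insert p {0<..<p})" using p by auto
  finally have "(a + b) ^ p - (a ^ p + b ^ p) = (\<Sum>k\<in>{0<..<p}. of_nat (p choose k) * a ^ k * b ^ (p - k))"
    using p by simp
  moreover have "of_nat p dvd (of_nat (p choose k) :: 'a)" if "k \<in> {0<..<p}" for k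
  proof -
    have "p dvd (p choose k)" using that assms p by (intro dvd_choose_prime) auto
    thus ?thesis by (auto elim!: dvdE)
  qed
  ultimately show ?thesis by (auto intro!: dvd_sum dvd_mult2)
qed

lemma prime_dvd_power_sum_diff:
  fixes f :: "'b \<Rightarrow> 'a :: comm_ring_1"
  assumes "prime p"
  shows "of_nat p dvd sum f A ^ p - (\<Sum>a\<in>A. f a ^ p)"
proof (induction A rule: infinite_finite_induct)
  case (insert x A)
  have "(f x + sum f A) ^ p - (f x ^ p + (\<Sum>a\<in>A. f a ^ p))
     = ((f x + sum f A) ^ p - (f x ^ p + sum f A ^ p)) + (sum f A ^ p - (\<Sum>a\<in>A. f a ^ p))"
    by simp
  moreover have "of_nat p dvd \<dots>"
    by (intro dvd_add prime_dvd_power_add_diff assms insert.IH)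
  ultimately show ?case by (simp only: sum.insert[OF insert.hyps])
qed (use prime_gt_0_nat[OF assms] in \<open>simp_all add: power_0_left\<close>)

text \<open>The group ring element with coefficient \<open>f a\<close> at the residue
  \<open>a\<close>. In the applications \<open>f\<close> is defined on all integers and periodic
  modulo \<open>q\<close>, so that differences such as \<open>n - a\<close> may be
  arguments.\<close>

definition gpoly :: "nat \<Rightarrow> (int \<Rightarrow> 'a :: comm_ring_1) \<Rightarrow> 'a poly" where
  "gpoly q f = (\<Sum>a\<in>{0..<int q}. monom (f a) (nat a))"

lemma monom_sum: "monom (\<Sum>a\<in>A. f a) n = (\<Sum>a\<in>A. monom (f a) n)"
  by (induction A rule: infinite_finite_induct) (simp_all flip: add_monom)

lemma smult_sum_right: "smult c (sum f A) = (\<Sum>a\<in>A. smult c (f a))"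
  by (induction A rule: infinite_finite_induct) (simp_all add: smult_add_right)

lemma smult_gpoly: "smult c (gpoly q f) = gpoly q (\<lambda>n. c * f n)"
  by (simp add: gpoly_def smult_sum_right smult_monom)

text \<open>Multiplication in the group ring is convolution. For fixed \<open>a\<close> the sum over
  \<open>b\<close> becomes a sum over \<open>n = a + b\<close> modulo \<open>q\<close>, where the
  periodicity of \<open>g\<close> enters.\<close>

lemma pcong_gpoly_mult:
  assumes "q > 0" and per: "\<And>a. g (a mod int q) = g a"
  shows "pcong c q (gpoly q f * gpoly q g) (gpoly q (\<lambda>n. \<Sum>a\<in>{0..<int q}. f a * g (n - a)))"
proof -
  have "gpoly q f * gpoly q g
      = (\<Sum>a\<in>{0..<int q}. \<Sum>b\<in>{0..<int q}. monom (f a * g b) (nat a + nat b))"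
    by (simp add: gpoly_def sum_product mult_monom)
  also have "pcong c q \<dots> (\<Sum>a\<in>{0..<int q}. \<Sum>b\<in>{0..<int q}. monom (f a * g b) ((nat a + nat b) mod q))"
    by (intro pcong_sum pcong_monom_mod)
  also have "(\<Sum>a\<in>{0..<int q}. \<Sum>b\<in>{0..<int q}. monom (f a * g b) ((nat a + nat b) mod q))
      = (\<Sum>a\<in>{0..<int q}. \<Sum>n\<in>{0..<int q}. monom (f a * g (n - a)) (nat n))"
  proof (rule sum.cong[OF refl])
    fix a assume a: "a \<in> {0..<int q}"
    let ?F = "\<lambda>n. monom (f a * g (n - a)) (nat (n mod int q))"
    have "(\<Sum>b\<in>{0..<int q}. monom (f a * g b) ((nat a + nat b) mod q)) = (\<Sum>b\<in>{0..<int q}. ?F (1 * b + a))"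
    proof (rule sum.cong[OF refl])
      fix b assume "b \<in> {0..<int q}"
      hence "(nat a + nat b) mod q = nat ((b + a) mod int q)"
        using a by (simp add: nat_mod_distrib nat_add_distrib add.commute)
      thus "monom (f a * g b) ((nat a + nat b) mod q) = ?F (1 * b + a)" by simp
    qed
    also have "\<dots> = (\<Sum>n\<in>{0..<int q}. ?F n)"
    proof (rule sum_periodic_affine)
      show "monom (f a * g (n mod int q - a)) (nat (n mod int q mod int q)) = ?F n" for n
        by (simp, metis mod_diff_left_eq per)
    qed (use assms(1) in auto)
    finally show "(\<Sum>b\<in>{0..<int q}. monom (f a * g b) ((nat a + nat b) mod q))
        = (\<Sum>n\<in>{0..<int q}. monom (f a * g (n - a)) (nat n))" by simp
  qed
  also have "\<dots> = gpoly q (\<lambda>n. \<Sum>a\<in>{0..<int q}. f a * g (n - a))"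
    unfolding gpoly_def monom_sum by (rule sum.swap)
  finally show ?thesis .
qed

text \<open>Frobenius: modulo \<open>p\<close>, the power moves the term at \<open>a\<close> to
  \<open>p * a\<close> and raises its coefficient to the power \<open>p\<close>. The inverse
  \<open>e\<close> of \<open>p\<close> modulo \<open>q\<close> expresses the result through the new
  index.\<close>

lemma pcong_gpoly_power_prime:
  assumes "prime p" "q > 0" and e: "[e * int p = 1] (mod int q)"
    and per: "\<And>a. f (a mod int q) = f a"
  shows "pcong (of_nat p) q (gpoly q f ^ p) (gpoly q (\<lambda>n. f (e * n) ^ p))"
proof -
  let ?F = "\<lambda>n. monom (f (e * n) ^ p) (nat (n mod int q))"
  obtain u where "gpoly q f ^ p - (\<Sum>a\<in>{0..<int q}. monom (f a) (nat a) ^ p) = of_nat p * u"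
    using prime_dvd_power_sum_diff[OF assms(1)] unfolding gpoly_def dvd_def by blast
  hence "gpoly q f ^ p - (\<Sum>a\<in>{0..<int q}. monom (f a) (nat a) ^ p) = smult (of_nat p) u + (monom 1 q - 1) * 0"
    by (simp add: of_nat_poly)
  hence "pcong (of_nat p) q (gpoly q f ^ p) (\<Sum>a\<in>{0..<int q}. monom (f a) (nat a) ^ p)"
    unfolding pcong_def by blast
  also have "pcong (of_nat p) q \<dots> (\<Sum>a\<in>{0..<int q}. monom (f a ^ p) ((nat a * p) mod q))"
    unfolding monom_power by (intro pcong_sum pcong_monom_mod)
  also have "(\<Sum>a\<in>{0..<int q}. monom (f a ^ p) ((nat a * p) mod q)) = (\<Sum>a\<in>{0..<int q}. ?F (int p * a + 0))"
  proof (rule sum.cong[OF refl])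
    fix a assume a: "a \<in> {0..<int q}"
    have "(nat a * p) mod q = nat ((int p * a) mod int q)"
      using a by (simp add: nat_mod_distrib nat_mult_distrib mult.commute)
    moreover have "[e * (int p * a) = a] (mod int q)"
      using cong_mult[OF e cong_refl[of a]] by (simp add: mult_ac)
    hence "f (e * (int p * a)) = f a" by (metis cong_def per)
    ultimately show "monom (f a ^ p) ((nat a * p) mod q) = ?F (int p * a + 0)" by simp
  qed
  also have "\<dots> = (\<Sum>n\<in>{0..<int q}. ?F n)"
  proof (intro sum_periodic_affine)
    show "coprime (int p) (int q)"
      using e by (metis coprime_iff_invertible_int mult.commute)
    show "monom (f (e * (a mod int q)) ^ p) (nat (a mod int q mod int q)) = ?F a" for a
      by (simp, metis mod_mult_right_eq per)
  qed (use assms(2) in auto)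
  also have "\<dots> = gpoly q (\<lambda>n. f (e * n) ^ p)"
    by (simp add: gpoly_def)
  finally show ?thesis .
qed

lemma gpoly_coeff: "n < q \<Longrightarrow> coeff (gpoly q f) n = f (int n)"
proof -
  assume "n < q"
  have "coeff (gpoly q f) n = (\<Sum>a\<in>{0..<int q}. if a = int n then f a else 0)"
    unfolding gpoly_def coeff_sum by (intro sum.cong) auto
  thus ?thesis using \<open>n < q\<close> by simp
qed

lemma gpoly_degree: "q > 0 \<Longrightarrow> degree (gpoly q f) < q"
  unfolding gpoly_def
  by (intro degree_sum_less le_less_trans[OF degree_monom_le]) auto

text \<open>The coefficient at 1 is chosen because \<open>chi\<close> and \<open>psi\<close> equal 1
  there and \<open>kappa\<close> equals -1, so that scalar factors can be read off.\<close>

lemma pcong_gpoly_imp_dvd: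
  assumes "pcong c q (gpoly q f) (gpoly q g)" "q > 1"
  shows "c dvd f 1 - g 1"
  using pcong_coeff[OF assms(1) gpoly_degree gpoly_degree, of 1] assms(2) by (simp add: gpoly_coeff)

subsection \<open>The cubic residue character\<close>

definition dcong :: "'a :: comm_ring_1 \<Rightarrow> 'a \<Rightarrow> 'a \<Rightarrow> bool" where
  "dcong c x y \<longleftrightarrow> c dvd x - y"

lemma dcong_refl [simp, intro]: "dcong c x x"
  by (simp add: dcong_def)

lemma dcong_sym: "dcong c x y \<Longrightarrow> dcong c y x"
  unfolding dcong_def by (metis dvd_minus_iff minus_diff_eq)

lemma dcong_trans [trans]: "dcong c x y \<Longrightarrow> dcong c y z \<Longrightarrow> dcong c x z"
  unfolding dcong_def by (drule (1) dvd_add) simp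

lemma dcong_add: "dcong c x y \<Longrightarrow> dcong c x' y' \<Longrightarrow> dcong c (x + x') (y + y')"
  unfolding dcong_def by (drule (1) dvd_add) (simp add: algebra_simps)

lemma dcong_mult: "dcong c x y \<Longrightarrow> dcong c x' y' \<Longrightarrow> dcong c (x * x') (y * y')"
proof (unfold dcong_def)
  assume "c dvd x - y" "c dvd x' - y'"
  hence "c dvd (x - y) * x' + y * (x' - y')" by simp
  thus "c dvd x * x' - y * y'" by (simp add: algebra_simps)
qed

lemma dcong_power: "dcong c x y \<Longrightarrow> dcong c (x ^ n) (y ^ n)"
  by (induction n) (auto intro: dcong_mult)

text \<open>\<open>w\<close> is a primitive cube root of unity modulo \<open>q\<close>; choosing one
  of the two selects one of the two conjugate cubic characters.\<close>

locale cubic_character =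
  fixes q :: nat and w :: int
  assumes prime_q: "prime q" and q_mod_3: "q mod 3 = 1"
    and w: "[w ^ 2 + w + 1 = 0] (mod int q)"
begin

text \<open>Reduction modulo a prime above \<open>q\<close>; it is multiplicative only modulo \<open>q\<close>.\<close>

definition red :: "eisenstein \<Rightarrow> int" where
  "red z = re_part z + om_part z * w"

lemma red_simps [simp]:
  "red 0 = 0" "red 1 = 1" "red omega = w" "red (x + y) = red x + red y" "red (of_nat n) = int n"
  by (simp_all add: red_def algebra_simps)

lemma red_sum: "red (sum f A) = (\<Sum>a\<in>A. red (f a))"
  by (induction A rule: infinite_finite_induct) simp_all

lemma red_mult: "[red (x * y) = red x * red y] (mod int q)"
proof -
  have "red x * red y - red (x * y) = om_part x * om_part y * (w ^ 2 + w + 1)"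
    by (simp add: red_def algebra_simps power2_eq_square)
  thus ?thesis using w by (metis cong_0_iff cong_iff_dvd_diff cong_sym dvd_mult)
qed

lemma red_mult_cong: "[red x = a] (mod int q) \<Longrightarrow> [red y = b] (mod int q) \<Longrightarrow> [red (x * y) = a * b] (mod int q)"
  by (meson cong_mult cong_trans red_mult)

definition m :: nat where "m = (q - 1) div 3"

lemma m: "q = 3 * m + 1" "m > 0"
proof -
  show "q = 3 * m + 1" using q_mod_3 unfolding m_def by presburger
  thus "m > 0" using prime_gt_1_nat[OF prime_q] by simp
qed

lemma q_gt: "q > 3" "q > 1" "q > 0" using m by linarith+

lemma prime_int_q: "prime (int q)" using prime_q by simp

lemma not_dvd_3: "\<not> int q dvd 3"
  using q_gt zdvd_imp_le[of "int q" 3] by auto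

definition units :: "eisenstein set" where "units = {1, omega, omega ^ 2}"

lemma units_mult: "x \<in> units \<Longrightarrow> y \<in> units \<Longrightarrow> x * y \<in> units"
proof -
  have "omega * omega ^ 2 = 1" "omega ^ 2 * omega = 1" "omega ^ 2 * omega ^ 2 = omega"
    by (auto intro!: eisenstein.expand simp: power2_eq_square)
  thus "x \<in> units \<Longrightarrow> y \<in> units \<Longrightarrow> x * y \<in> units"
    by (auto simp: units_def simp flip: power2_eq_square)
qed

lemma units_cube: "x \<in> units \<Longrightarrow> x ^ 3 = 1"
proof -
  have "(omega ^ 2) ^ 3 = (omega ^ 3) ^ 2" by (simp flip: power_mult)
  thus "x \<in> units \<Longrightarrow> x ^ 3 = 1" using omega_cube by (auto simp: units_def)
qed

lemma red_omega2: "red (omega ^ 2) = -1 - w"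
  by (simp add: red_def power2_eq_square)

text \<open>If two of 1, \<open>w\<close>, \<open>-1 - w\<close> agreed modulo \<open>q\<close>,
  then \<open>q\<close> would divide 3, by \<open>w ^ 2 + w + 1 = (w - 1) * (w + 2) + 3\<close> or
  \<open>4 * (w ^ 2 + w + 1) = (2 * w + 1) ^ 2 + 3\<close>.\<close>

lemma red_units_inj:
  assumes "x \<in> units" "y \<in> units" "[red x = red y] (mod int q)"
  shows "x = y"
proof -
  have w': "int q dvd w ^ 2 + w + 1" using w by (simp add: cong_0_iff)
  have 1: "\<not> int q dvd w - 1"
  proof
    assume "int q dvd w - 1"
    from dvd_diff[OF w' dvd_mult2[OF this, of "w + 2"]]
    have "int q dvd w ^ 2 + w + 1 - (w - 1) * (w + 2)" .
    thus False using not_dvd_3 by (simp add: algebra_simps power2_eq_square)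
  qed
  have 2: "\<not> int q dvd w + 2"
  proof
    assume "int q dvd w + 2"
    from dvd_diff[OF w' dvd_mult2[OF this, of "w - 1"]]
    have "int q dvd w ^ 2 + w + 1 - (w + 2) * (w - 1)" .
    thus False using not_dvd_3 by (simp add: algebra_simps power2_eq_square)
  qed
  have 3: "\<not> int q dvd 2 * w + 1"
  proof
    assume "int q dvd 2 * w + 1"
    from dvd_diff[OF dvd_mult[OF w', of 4] dvd_mult2[OF this, of "2 * w + 1"]]
    have "int q dvd 4 * (w ^ 2 + w + 1) - (2 * w + 1) * (2 * w + 1)" .
    thus False using not_dvd_3 by (simp add: algebra_simps power2_eq_square)
  qed
  have eqs: "1 - w = - (w - 1)" "1 - (-1 - w) = w + 2" "w - (-1 - w) = 2 * w + 1"
     "-1 - w - 1 = - (w + 2)" "-1 - w - w = - (2 * w + 1)" by simp_all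
  from assms show ?thesis
    unfolding units_def cong_iff_dvd_diff
    using 1 2 3 by (elim insertE emptyE) (simp_all only: red_omega2 red_simps eqs dvd_minus_iff simp_thms)
qed

text \<open>By Fermat, \<open>a ^ m\<close> is a root of \<open>x ^ 3 - 1\<close>, which splits
  modulo \<open>q\<close> with roots 1, \<open>w\<close>, \<open>-1 - w\<close>.\<close>

lemma power_m_cases:
  assumes "\<not> int q dvd a"
  shows "\<exists>z\<in>units. [red z = a ^ m] (mod int q)"
proof -
  define b where "b = nat (a mod int q)"
  have b: "int b = a mod int q" using q_gt by (simp add: b_def)
  hence "\<not> q dvd b" using assms by (metis dvd_mod_iff dvd_refl int_dvd_int_iff)
  hence "[b ^ (q - 1) = 1] (mod q)" using prime_q by (rule fermat_theorem[rotated])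
  hence "[int b ^ (q - 1) = 1] (mod int q)" by (metis cong_int_iff of_nat_1 of_nat_power)
  hence "[(a mod int q) ^ (q - 1) = 1] (mod int q)" by (simp add: b)
  hence "[a ^ (q - 1) = 1] (mod int q)" by (simp add: cong_def power_mod)
  moreover have "q - 1 = m * 3" using m by simp
  ultimately have 1: "int q dvd (a ^ m) ^ 3 - 1" by (simp add: cong_iff_dvd_diff power_mult)
  define x where "x = a ^ m"
  have "x ^ 3 - 1 = (x - 1) * ((x - w) * (x - (-1 - w))) + (x - 1) * (w ^ 2 + w + 1)"
    by (simp add: algebra_simps power2_eq_square power3_eq_cube)
  hence "int q dvd (x - 1) * ((x - w) * (x - (-1 - w)))"
    using 1 w unfolding x_def[symmetric] cong_0_iff by (simp add: dvd_add_left_iff)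
  hence "int q dvd x - 1 \<or> int q dvd x - w \<or> int q dvd x - (-1 - w)"
    by (simp only: prime_dvd_mult_iff[OF prime_int_q])
  hence "[red 1 = x] (mod int q) \<or> [red omega = x] (mod int q) \<or> [red (omega ^ 2) = x] (mod int q)"
    by (metis cong_iff_dvd_diff cong_sym red_omega2 red_simps(2) red_simps(3))
  thus ?thesis unfolding x_def units_def by blast
qed

text \<open>The cubic residue character by Euler's criterion, with \<open>a ^ m\<close> lifted to an
  exact cube root of unity.\<close>

definition chi :: "int \<Rightarrow> eisenstein" where
  "chi a = (if int q dvd a then 0 else (THE z. z \<in> units \<and> [red z = a ^ m] (mod int q)))"

lemma chi_eqI:
  assumes "\<not> int q dvd a" "z \<in> units" "[red z = a ^ m] (mod int q)"
  shows "chi a = z"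
  unfolding chi_def
  using assms by (auto intro!: the_equality red_units_inj intro: cong_trans cong_sym)

lemma chi:
  assumes "\<not> int q dvd a"
  shows "chi a \<in> units" "[red (chi a) = a ^ m] (mod int q)"
  using power_m_cases[OF assms] chi_eqI[OF assms] by (metis, metis)

lemma chi_0 [simp]: "int q dvd a \<Longrightarrow> chi a = 0"
  by (simp add: chi_def)

lemma red_chi: "[red (chi a) = a ^ m] (mod int q)"
proof (cases "int q dvd a")
  case True
  hence "int q dvd a ^ m" by (rule dvd_trans[OF _ dvd_power]) (use m in simp)
  thus ?thesis using True by (simp add: cong_0_iff cong_sym_eq[of 0])
qed (rule chi)

lemma chi_mult: "chi (a * b) = chi a * chi b"
proof (cases "int q dvd a \<or> int q dvd b")
  case False
  hence "\<not> int q dvd a * b" using prime_int_q by (simp add: prime_dvd_mult_iff)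
  thus ?thesis
    by (intro chi_eqI units_mult chi) (use False in \<open>auto simp: power_mult_distrib intro: red_mult_cong chi\<close>)
qed auto

lemma chi_mod [simp]: "chi (a mod int q) = chi a"
proof (cases "int q dvd a")
  case False
  have "\<not> int q dvd a mod int q" using False by (simp add: dvd_mod_iff)
  moreover have "[red (chi a) = (a mod int q) ^ m] (mod int q)"
    using chi(2)[OF False] by (simp add: cong_def power_mod)
  ultimately show ?thesis using chi[OF False] by (intro chi_eqI)
qed auto

lemma chi_cong: "[a = b] (mod int q) \<Longrightarrow> chi a = chi b"
  by (metis chi_mod cong_def)

lemma chi_cube: "\<not> int q dvd a \<Longrightarrow> chi a ^ 3 = 1"
  by (simp add: chi units_cube)

lemma chi_1 [simp]: "chi 1 = 1"
  using q_gt by (intro chi_eqI) (auto simp: units_def)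

lemma not_dvd_minus1: "\<not> int q dvd -1" 
  using q_gt by simp

text \<open>The value at -1 has order dividing both 2 and 3.\<close>

lemma chi_minus: "chi (- a) = chi a"
proof -
  have "chi (-1) * chi (-1) = 1" by (simp flip: chi_mult)
  moreover have "chi (-1) ^ 3 = 1" using not_dvd_minus1 by (rule chi_cube)
  ultimately have "chi (-1) = 1" by (simp add: power3_eq_cube)
  thus ?thesis using chi_mult[of "-1" a] by simp
qed

section \<open>Primitive roots and vanishing sums over residues\<close>

lemma primitive_root: "\<exists>g. \<not> int q dvd g \<and> (\<forall>k. 0 < k \<and> k < q - 1 \<longrightarrow> \<not> [g ^ k = 1] (mod int q))"
proof -
  obtain g where g: "residue_primroot q g" using prime_primitive_root_exists[OF q_gt(2) prime_q] by auto
  hence "coprime q g" "ord q g = q - 1" using prime_q by (auto simp: residue_primroot_def totient_prime)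
  hence "\<not> q dvd g" using q_gt by (metis coprime_absorb_left nat_dvd_1_iff_1 less_irrefl)
  moreover have "\<not> [int g ^ k = 1] (mod int q)" if "0 < k" "k < q - 1" for k
  proof
    assume "[int g ^ k = 1] (mod int q)"
    hence "[g ^ k = 1] (mod q)" by (metis cong_int_iff of_nat_1 of_nat_power)
    hence "q - 1 dvd k" using \<open>ord q g = q - 1\<close> ord_divides[of g k q] by simp
    thus False using that by (auto dest: dvd_imp_le)
  qed
  ultimately show ?thesis by (intro exI[of _ "int g"]) auto
qed

lemma coprime_q: "\<not> int q dvd a \<Longrightarrow> coprime a (int q)"
  using prime_int_q by (metis coprime_commute prime_imp_coprime)

text \<open>Multiplication by a primitive root \<open>g\<close> permutes the residues, so the sum is
  fixed by the factor \<open>g ^ k\<close>, which is not 1 modulo \<open>q\<close>.\<close>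

lemma power_sum_cong_0:
  assumes "0 < k" "k < q - 1"
  shows "[(\<Sum>a\<in>{0..<int q}. a ^ k) = 0] (mod int q)"
proof -
  obtain g where g: "\<not> int q dvd g" "\<not> [g ^ k = 1] (mod int q)"
    using primitive_root assms by blast
  define S where "S = (\<Sum>a\<in>{0..<int q}. a ^ k)"
  \<comment> \<open>The terms are reduced modulo \<open>q\<close> to make them exactly
    periodic.\<close>
  have "(\<Sum>a\<in>{0..<int q}. (g * a + 0) ^ k mod int q) = (\<Sum>a\<in>{0..<int q}. a ^ k mod int q)"
    using g q_gt by (intro sum_periodic_affine coprime_q) (auto simp: power_mod)
  hence "(\<Sum>a\<in>{0..<int q}. g ^ k * a ^ k mod int q) mod int q = (\<Sum>a\<in>{0..<int q}. a ^ k mod int q) mod int q"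
    by (simp add: power_mult_distrib)
  hence "[(\<Sum>a\<in>{0..<int q}. g ^ k * a ^ k) = S] (mod int q)"
    unfolding S_def cong_def mod_sum_eq .
  hence "[g ^ k * S = S] (mod int q)" by (simp add: S_def sum_distrib_left)
  hence "int q dvd (g ^ k - 1) * S" by (simp add: cong_iff_dvd_diff left_diff_distrib)
  thus ?thesis using g(2) unfolding S_def
    by (simp add: prime_dvd_mult_iff[OF prime_int_q] cong_iff_dvd_diff)
qed

lemma sum_chi: "(\<Sum>a\<in>{0..<int q}. chi a) = 0"
proof -
  obtain g where g: "\<not> int q dvd g" "\<not> [g ^ m = 1] (mod int q)"
    using primitive_root m by (auto dest: spec[of _ m])
  define S where "S = (\<Sum>a\<in>{0..<int q}. chi a)"
  have "(\<Sum>a\<in>{0..<int q}. chi (g * a + 0)) = S" unfolding S_def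
    using g q_gt by (intro sum_periodic_affine coprime_q) auto
  hence S: "chi g * S = S" by (simp add: chi_mult S_def sum_distrib_left)
  have "chi g \<noteq> 1" using chi(2)[OF g(1)] g(2) by (auto simp: cong_sym_eq)
  \<comment> \<open>As \<open>eisenstein\<close> is only set up as a commutative ring,
    \<open>chi g - 1\<close> is not cancelled; this relation gives \<open>3 * S = 0\<close> instead,
    which is then solved in coordinates.\<close>
  hence "1 + chi g + chi g ^ 2 = 0" using chi(1)[OF g(1)]
    by (auto simp: units_def power2_eq_square intro!: eisenstein.expand)
  hence "0 = (1 + chi g + chi g ^ 2) * S" by simp
  also have "\<dots> = S + chi g * S + chi g * (chi g * S)" by (simp add: algebra_simps power2_eq_square)
  also have "\<dots> = S + S + S" by (simp add: S)
  finally have "S + S + S = 0" by simp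
  hence "re_part (S + S + S) = 0" "om_part (S + S + S) = 0" by simp_all
  thus ?thesis unfolding S_def[symmetric] by (intro eisenstein.expand) simp
qed

subsection \<open>Gauss and Jacobi sums\<close>

definition psi :: "int \<Rightarrow> eisenstein" where "psi a = eis_cnj (chi a)"

text \<open>The coefficients of \<open>q\<close> minus the sum of all group elements.\<close>

definition kappa :: "int \<Rightarrow> eisenstein" where
  "kappa a = (if int q dvd a then of_nat q else 0) - 1"

definition J :: eisenstein where
  "J = (\<Sum>a\<in>{0..<int q}. chi a * chi (1 - a))"

lemma cnj_units: "z \<in> units \<Longrightarrow> eis_cnj z = z ^ 2 \<and> z * eis_cnj z = 1"
  by (auto simp: units_def eis_cnj_def power2_eq_square intro!: eisenstein.expand)

lemma psi_simps [simp]: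
  "int q dvd a \<Longrightarrow> psi a = 0" "psi (a mod int q) = psi a" "psi 1 = 1"
  by (simp_all add: psi_def)

lemma chi_psi: "\<not> int q dvd a \<Longrightarrow> chi a * psi a = 1"
  unfolding psi_def using chi(1) cnj_units by blast

lemma psi_eq: "psi a = chi a ^ 2"
proof (cases "int q dvd a")
  case False
  thus ?thesis unfolding psi_def using chi(1) cnj_units by blast
qed simp

lemma psi_mult: "psi (a * b) = psi a * psi b"
  by (simp add: psi_eq chi_mult power_mult_distrib)

lemma kappa_mod [simp]: "kappa (a mod int q) = kappa a"
  by (simp add: kappa_def dvd_mod_iff)

section \<open>Convolutions of the characters\<close>

lemma sum_periodic_mult:
  assumes "\<And>a. F (a mod int q) = F a" "\<not> int q dvd n"
  shows "(\<Sum>a\<in>{0..<int q}. F a) = (\<Sum>a\<in>{0..<int q}. F (n * a))"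
  using sum_periodic_affine[of "int q" n F 0] assms q_gt coprime_q by simp

lemma sum_periodic_diff:
  assumes "\<And>a. F (a mod int q) = F a"
  shows "(\<Sum>a\<in>{0..<int q}. F (n - a)) = (\<Sum>a\<in>{0..<int q}. F a)"
  using sum_periodic_affine[of "int q" "-1" F n] assms q_gt by simp

lemma chi_diff_mod: "chi (n - a mod int q) = chi (n - a)"
  by (metis chi_mod mod_diff_right_eq)

lemma psi_diff_mod: "psi (n - a mod int q) = psi (n - a)"
  by (metis psi_simps(2) mod_diff_right_eq)

lemma sum_psi: "(\<Sum>a\<in>{0..<int q}. psi a) = 0"
  using arg_cong[OF sum_chi, of eis_cnj] by (simp add: psi_def eis_cnj_sum)

lemma nat_range_split: "{0..<int q} = insert 0 {1..<int q}"
  using q_gt by auto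

lemma not_dvd_range: "a \<in> {1..<int q} \<Longrightarrow> \<not> int q dvd a"
  using zdvd_imp_le by fastforce

text \<open>Replacing \<open>a\<close> by \<open>n * a\<close> takes out \<open>chi n ^ 2\<close>,
  which is \<open>psi n\<close>. At multiples of \<open>q\<close> the sum becomes that of
  \<open>psi\<close>, which vanishes.\<close>

lemma conv_chi_chi: "(\<Sum>a\<in>{0..<int q}. chi a * chi (n - a)) = J * psi n"
proof (cases "int q dvd n")
  case True
  have "chi (n - a) = chi a" for a
    using True chi_minus[of a] chi_cong[of "n - a" "- a"] by (simp add: cong_iff_dvd_diff)
  hence "(\<Sum>a\<in>{0..<int q}. chi a * chi (n - a)) = (\<Sum>a\<in>{0..<int q}. psi a)"
    by (simp add: psi_eq power2_eq_square)
  thus ?thesis using True sum_psi by simp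
next
  case False
  have "(\<Sum>a\<in>{0..<int q}. chi a * chi (n - a)) = (\<Sum>a\<in>{0..<int q}. chi (n * a) * chi (n - n * a))"
    using False by (intro sum_periodic_mult) (simp_all add: chi_diff_mod)
  also have "\<dots> = (\<Sum>a\<in>{0..<int q}. chi n ^ 2 * (chi a * chi (1 - a)))"
  proof (rule sum.cong[OF refl])
    fix a
    have "chi (n - n * a) = chi n * chi (1 - a)" by (simp flip: chi_mult add: algebra_simps)
    thus "chi (n * a) * chi (n - n * a) = chi n ^ 2 * (chi a * chi (1 - a))"
      by (simp add: chi_mult power2_eq_square mult_ac)
  qed
  also have "\<dots> = J * psi n" by (simp add: J_def psi_eq mult.commute flip: sum_distrib_left)
  finally show ?thesis .
qed

lemma conv_psi_psi: "(\<Sum>a\<in>{0..<int q}. psi a * psi (n - a)) = eis_cnj J * chi n"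
proof -
  have "eis_cnj (psi n) = chi n" by (rule eisenstein.expand) (simp add: psi_def eis_cnj_def)
  thus ?thesis using arg_cong[OF conv_chi_chi[of n], of eis_cnj] by (simp add: eis_cnj_sum psi_def)
qed

text \<open>
  The convolution is constant off the multiples of \<open>q\<close>; the constant is found by summing over
  all residues, which gives the product of the two vanishing character sums.
\<close>

lemma conv_chi_psi: "(\<Sum>a\<in>{0..<int q}. chi a * psi (n - a)) = kappa n"
proof -
  define C where "C n = (\<Sum>a\<in>{0..<int q}. chi a * psi (n - a))" for n
  have 0: "C n = of_nat q - 1" if "int q dvd n" for n
  proof -
    have "psi (n - a) = psi a" for a
      using that chi_minus[of a] chi_cong[of "n - a" "- a"] by (simp add: psi_def cong_iff_dvd_diff)
    hence "C n = (\<Sum>a\<in>{0..<int q}. chi a * psi a)" by (simp add: C_def)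
    also have "\<dots> = (\<Sum>a\<in>{1..<int q}. 1)"
      unfolding nat_range_split by (simp add: chi_psi not_dvd_range)
    also have "\<dots> = of_nat q - 1" using q_gt by (simp add: of_nat_diff)
    finally show ?thesis .
  qed
  have 1: "C n = C 1" if "\<not> int q dvd n" for n
  proof -
    have "C n = (\<Sum>a\<in>{0..<int q}. chi (n * a) * psi (n - n * a))" unfolding C_def
      using that by (intro sum_periodic_mult) (simp_all add: psi_diff_mod)
    also have "\<dots> = (\<Sum>a\<in>{0..<int q}. chi n * psi n * (chi a * psi (1 - a)))"
    proof (rule sum.cong[OF refl])
      fix a
      have "psi (n - n * a) = psi n * psi (1 - a)" by (simp flip: psi_mult add: algebra_simps)
      thus "chi (n * a) * psi (n - n * a) = chi n * psi n * (chi a * psi (1 - a))"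
        by (simp add: chi_mult mult_ac)
    qed
    finally show ?thesis using that by (simp add: C_def chi_psi)
  qed
  have "(\<Sum>n\<in>{0..<int q}. C n) = (\<Sum>a\<in>{0..<int q}. chi a * (\<Sum>n\<in>{0..<int q}. psi (n - a)))"
    unfolding C_def sum_distrib_left by (rule sum.swap)
  also have "\<dots> = 0"
    using sum_periodic_affine[of "int q" 1 psi "- a" for a] q_gt sum_psi by simp
  finally have "(\<Sum>n\<in>{0..<int q}. C n) = 0" by simp
  moreover have "(\<Sum>n\<in>{0..<int q}. C n) = (of_nat q - 1) + (\<Sum>n\<in>{1..<int q}. C 1)"
  proof -
    have "(\<Sum>n\<in>{1..<int q}. C n) = (\<Sum>n\<in>{1..<int q}. C 1)"
      by (intro sum.cong refl 1 not_dvd_range)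
    thus ?thesis unfolding nat_range_split using 0[of 0] by simp
  qed
  moreover have "(\<Sum>n\<in>{1..<int q}. C 1) = (of_nat q - 1) * C 1"
    using q_gt by (simp add: of_nat_diff nat_diff_distrib)
  ultimately have "(of_nat q - 1) + (of_nat q - 1) * C 1 = 0" by simp
  hence "(of_nat q - 1) * (1 + C 1) = 0" by (simp only: distrib_left mult_1_right)
  hence "re_part ((of_nat q - 1) * (1 + C 1)) = 0" "om_part ((of_nat q - 1) * (1 + C 1)) = 0" by simp_all
  hence "C 1 = -1" using q_gt by (intro eisenstein.expand) auto
  hence "C n = kappa n" using 0[of n] 1[of n] by (cases "int q dvd n") (auto simp: kappa_def)
  thus ?thesis by (simp add: C_def)
qed

text \<open>The sum of all group elements annihilates functions of total 0, so only the multiple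
  \<open>q\<close> of the identity in \<open>kappa\<close> acts.\<close>

lemma conv_kappa:
  assumes "\<And>a. g (a mod int q) = g a" "(\<Sum>a\<in>{0..<int q}. g a) = 0"
  shows "(\<Sum>a\<in>{0..<int q}. kappa a * g (n - a)) = of_nat q * g n"
proof -
  have "(\<Sum>a\<in>{0..<int q}. kappa a * g (n - a))
      = (\<Sum>a\<in>{0..<int q}. (if int q dvd a then of_nat q * g (n - a) else 0) - g (n - a))"
    by (intro sum.cong) (auto simp: kappa_def left_diff_distrib)
  also have "\<dots> = (\<Sum>a\<in>{0..<int q}. if int q dvd a then of_nat q * g (n - a) else 0)
      - (\<Sum>a\<in>{0..<int q}. g (n - a))"
    by (rule sum_subtractf)
  also have "(\<Sum>a\<in>{0..<int q}. g (n - a)) = 0"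
    using sum_periodic_diff[of g n] assms by simp
  also have "(\<Sum>a\<in>{0..<int q}. if int q dvd a then of_nat q * g (n - a) else 0) = of_nat q * g n"
    unfolding nat_range_split by (simp add: not_dvd_range)
  finally show ?thesis by simp
qed

lemma sum_kappa: "(\<Sum>a\<in>{0..<int q}. kappa a) = 0"
  unfolding nat_range_split using q_gt
  by (simp add: kappa_def not_dvd_range sum_subtractf of_nat_diff)

text \<open>The Gauss sums of \<open>chi\<close> and of its conjugate, and their product
  \<open>K\<close>. In a cyclotomic field the product would be \<open>q\<close>; here
  \<open>K\<close> only acts as \<open>q\<close> on \<open>G\<close> and on itself.\<close>

definition G where "G = gpoly q chi"
definition H where "H = gpoly q psi"
definition K where "K = gpoly q kappa"

text \<open>The identities are exact, so \<open>c\<close> is arbitrary; later it is 0, 3 and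
  \<open>p\<close>.\<close>

lemma pcong_Gauss:
  "pcong c q (G * G) (smult J H)" "pcong c q (H * H) (smult (eis_cnj J) G)"
  "pcong c q (G * H) K" "pcong c q (K * G) (smult (of_nat q) G)"
  "pcong c q (K * K) (smult (of_nat q) K)"
  unfolding G_def H_def K_def smult_gpoly
  using pcong_gpoly_mult[of q chi c chi] pcong_gpoly_mult[of q psi c psi] pcong_gpoly_mult[of q psi c chi]
    pcong_gpoly_mult[of q chi c kappa] pcong_gpoly_mult[of q kappa c kappa] q_gt
  by (simp_all add: conv_chi_chi conv_psi_psi conv_chi_psi conv_kappa sum_chi sum_kappa)

lemma pcong_smult: "pcong c q f g \<Longrightarrow> pcong c q (smult a f) (smult a g)"
  using pcong_mult_left[of c q f g "[:a:]"] by simp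

text \<open>The counterpart of \<open>G ^ 3 = q * J\<close>: the factor \<open>q\<close> appears
  only after one more multiplication by \<open>G\<close>, through \<open>K * G\<close>.\<close>

lemma pcong_G_cube: "pcong c q (G ^ 3) (smult J K)"
proof -
  have "G ^ 3 = G * G * G" by (simp add: power3_eq_cube)
  also have "pcong c q \<dots> (smult J H * G)" by (intro pcong_mult pcong_Gauss pcong_refl)
  also have "smult J H * G = smult J (G * H)" by (simp add: mult.commute)
  also have "pcong c q \<dots> (smult J K)" by (intro pcong_smult pcong_Gauss)
  finally show ?thesis .
qed

lemma pcong_G_power:
  "pcong c q (G ^ (3 * n + 1)) (smult ((of_nat q * J) ^ n) G)"
  "pcong c q (G ^ (3 * n + 2)) (smult ((of_nat q * J) ^ n * J) H)"
proof -
  show 1: "pcong c q (G ^ (3 * n + 1)) (smult ((of_nat q * J) ^ n) G)"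
  proof (induction n)
    case (Suc n)
    have "3 * Suc n + 1 = 3 + (3 * n + 1)" by simp
    hence "G ^ (3 * Suc n + 1) = G ^ 3 * G ^ (3 * n + 1)" by (simp only: power_add)
    also have "pcong c q \<dots> (smult J K * smult ((of_nat q * J) ^ n) G)"
      by (intro pcong_mult pcong_G_cube Suc.IH)
    also have "\<dots> = smult (J * (of_nat q * J) ^ n) (K * G)" by (simp add: mult.commute)
    also have "pcong c q \<dots> (smult (J * (of_nat q * J) ^ n) (smult (of_nat q) G))"
      by (intro pcong_smult pcong_Gauss)
    finally show ?case by (simp add: mult_ac)
  qed simp
  have "G ^ (3 * n + 2) = G ^ (3 * n + 1) * G" by simp
  also have "pcong c q \<dots> (smult ((of_nat q * J) ^ n) G * G)" by (intro pcong_mult 1 pcong_refl)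
  also have "smult ((of_nat q * J) ^ n) G * G = smult ((of_nat q * J) ^ n) (G * G)" by simp
  also have "pcong c q \<dots> (smult ((of_nat q * J) ^ n) (smult J H))" by (intro pcong_smult pcong_Gauss)
  finally show "pcong c q (G ^ (3 * n + 2)) (smult ((of_nat q * J) ^ n * J) H)" by simp
qed

section \<open>Congruences and norm of the Jacobi sum\<close>

lemma inverse_mod_q:
  assumes "prime p" "p \<noteq> q"
  obtains e where "[e * int p = 1] (mod int q)" "\<not> int q dvd e" "\<not> int q dvd int p" "chi e = psi (int p)"
proof -
  have p: "\<not> int q dvd int p" using assms prime_q by (simp add: primes_dvd_imp_eq) (metis primes_dvd_imp_eq)
  obtain e where e: "[int p * e = 1] (mod int q)"
    using coprime_q[OF p] by (metis coprime_iff_invertible_int)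
  have "chi e * chi (int p) = 1" using chi_cong[OF e] by (simp add: chi_mult mult.commute)
  hence "chi e * (chi (int p) * psi (int p)) = psi (int p)" by (simp flip: mult.assoc)
  hence "chi e = psi (int p)" using chi_psi[OF p] by simp
  moreover have "\<not> int q dvd e"
    using \<open>chi e * chi (int p) = 1\<close> by (metis chi_0 mult_zero_left zero_neq_one)
  ultimately show ?thesis using that[of e] e p by (simp add: mult.commute)
qed

text \<open>Here the cube of the Gauss sum is computed in two ways, the second being Frobenius at 3.\<close>

lemma J_mod_3: "3 dvd re_part J + 1" "3 dvd om_part J"
proof -
  obtain e where e: "[e * int 3 = 1] (mod int q)" "\<not> int q dvd e"
    using inverse_mod_q[of 3] q_gt by auto
  have "pcong (of_nat 3) q (gpoly q (\<lambda>n. J * kappa n)) (gpoly q (\<lambda>n. chi (e * n) ^ 3))"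
    using pcong_trans[OF pcong_sym[OF pcong_G_cube[of "of_nat 3"]]
        pcong_gpoly_power_prime[of 3 q e chi, folded G_def]] e q_gt
    by (simp add: K_def smult_gpoly)
  \<comment> \<open>At 1 the two coefficients are \<open>- J\<close> and
    \<open>chi e ^ 3 = 1\<close>.\<close>
  from pcong_gpoly_imp_dvd[OF this q_gt(2)]
  have "of_nat 3 dvd - J - 1"
    using q_gt chi_cube[OF e(2)] by (simp add: kappa_def zdvd1_eq)
  hence "int 3 dvd re_part (- J - 1)" "int 3 dvd om_part (- J - 1)"
    unfolding eisenstein_of_nat_dvd_iff by auto
  thus "3 dvd re_part J + 1" "3 dvd om_part J" by (auto simp: dvd_diff_commute) presburger
qed

text \<open>The product of \<open>G * G\<close> and \<open>H * H\<close> is computed from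
  \<open>J * H\<close> and \<open>eis_cnj J * G\<close>, and again as \<open>K * K\<close>. With
  \<open>c = 0\<close> the comparison of coefficients is an equality.\<close>

lemma J_norm: "J * eis_cnj J = of_nat q"
proof -
  have "pcong 0 q (G * G * (H * H)) (smult J H * smult (eis_cnj J) G)"
    by (intro pcong_mult pcong_Gauss)
  also have "smult J H * smult (eis_cnj J) G = smult (J * eis_cnj J) (G * H)" by (simp add: mult_ac)
  also have "pcong 0 q \<dots> (smult (J * eis_cnj J) K)" by (intro pcong_smult pcong_Gauss)
  finally have 1: "pcong 0 q (G * G * (H * H)) (smult (J * eis_cnj J) K)" .
  have "G * G * (H * H) = G * H * (G * H)" by (simp add: mult_ac)
  also have "pcong 0 q \<dots> (K * K)" by (intro pcong_mult pcong_Gauss)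
  also have "pcong 0 q \<dots> (smult (of_nat q) K)" by (rule pcong_Gauss)
  finally have "pcong 0 q (smult (J * eis_cnj J) K) (smult (of_nat q) K)"
    using pcong_trans[OF pcong_sym[OF 1]] by blast
  from pcong_gpoly_imp_dvd[OF this[unfolded K_def smult_gpoly] q_gt(2)]
  show ?thesis using q_gt by (simp add: kappa_def zdvd1_eq)
qed

text \<open>Modulo \<open>q\<close> the sum becomes that of \<open>a ^ m * (1 - a) ^ m\<close>,
  whose exponents lie between \<open>m\<close> and \<open>2 * m < q - 1\<close>, so all power sums
  vanish. This later separates \<open>J\<close> from its conjugate.\<close>

lemma red_J: "[red J = 0] (mod int q)"
proof -
  have "[red J = (\<Sum>a\<in>{0..<int q}. a ^ m * (1 - a) ^ m)] (mod int q)"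
    unfolding J_def red_sum by (intro cong_sum red_mult_cong red_chi)
  also have "(\<Sum>a\<in>{0..<int q}. a ^ m * (1 - a) ^ m)
      = (\<Sum>a\<in>{0..<int q}. \<Sum>j\<le>m. int (m choose j) * (-1) ^ j * a ^ (m + j))"
  proof (rule sum.cong[OF refl])
    fix a :: int
    have "(1 - a) ^ m = (\<Sum>j\<le>m. of_nat (m choose j) * (- a) ^ j * 1 ^ (m - j))"
      using binomial_ring[of "- a" 1 m] by simp
    thus "a ^ m * (1 - a) ^ m = (\<Sum>j\<le>m. int (m choose j) * (-1) ^ j * a ^ (m + j))"
      by (simp add: sum_distrib_left power_minus[of a] power_add mult_ac)
  qed
  also have "\<dots> = (\<Sum>j\<le>m. int (m choose j) * (-1) ^ j * (\<Sum>a\<in>{0..<int q}. a ^ (m + j)))"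
    unfolding sum_distrib_left by (rule sum.swap)
  also have "[\<dots> = (\<Sum>j\<le>m. int (m choose j) * (-1) ^ j * 0)] (mod int q)"
    using m by (intro cong_sum cong_mult cong_refl power_sum_cong_0) auto
  finally show ?thesis by simp
qed

text \<open>The coefficient of \<open>G ^ p\<close> at 1 is found from \<open>pcong_G_power\<close>
  and from Frobenius; the latter gives \<open>chi e ^ p\<close>, where \<open>chi e\<close> is the
  inverse of \<open>chi (int p)\<close>.\<close>

lemma J_power_cong:
  assumes "prime p" "p \<noteq> q" "p \<noteq> 3"
  shows "p = 3 * n + 1 \<Longrightarrow> dcong (of_nat p) ((of_nat q * J) ^ n) (chi (int p) ^ 2)"
    and "p = 3 * n + 2 \<Longrightarrow> dcong (of_nat p) ((of_nat q * J) ^ n * J) (chi (int p))"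
proof -
  obtain e where e: "[e * int p = 1] (mod int q)" "\<not> int q dvd e" "\<not> int q dvd int p" "chi e = psi (int p)"
    using inverse_mod_q[OF assms(1,2)] by blast
  have F: "pcong (of_nat p) q (G ^ p) (gpoly q (\<lambda>n. chi (e * n) ^ p))"
    using pcong_gpoly_power_prime[OF assms(1) q_gt(3) e(1), of chi] by (simp add: G_def)
  have c3: "chi (int p) ^ 3 = 1" "chi e ^ 3 = 1" using chi_cube[OF e(3)] chi_cube[OF e(2)] by simp_all
  {
    assume p: "p = 3 * n + 1"
    have "pcong (of_nat p) q (gpoly q (\<lambda>a. (of_nat q * J) ^ n * chi a)) (gpoly q (\<lambda>n. chi (e * n) ^ p))"
      using pcong_trans[OF pcong_sym[OF pcong_G_power(1)] F[unfolded p]]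
      by (simp add: G_def smult_gpoly p)
    from pcong_gpoly_imp_dvd[OF this q_gt(2)]
    have "dcong (of_nat p) ((of_nat q * J) ^ n) (chi e ^ p)" by (simp add: dcong_def)
    also have "chi e ^ p = chi (int p) ^ 2"
      using c3 e(4) by (simp add: p power_add power_mult psi_eq)
    finally show "dcong (of_nat p) ((of_nat q * J) ^ n) (chi (int p) ^ 2)" .
  }
  {
    assume p: "p = 3 * n + 2"
    have "pcong (of_nat p) q (gpoly q (\<lambda>a. (of_nat q * J) ^ n * J * psi a)) (gpoly q (\<lambda>n. chi (e * n) ^ p))"
      using pcong_trans[OF pcong_sym[OF pcong_G_power(2)] F[unfolded p]]
      by (simp add: H_def smult_gpoly p)
    from pcong_gpoly_imp_dvd[OF this q_gt(2)]
    have "dcong (of_nat p) ((of_nat q * J) ^ n * J) (chi e ^ p)" by (simp add: dcong_def)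
    also have "chi e ^ p = chi e ^ 2"
      using c3 by (simp add: p power_add power_mult power2_eq_square)
    also have "\<dots> = chi (int p) * chi (int p) ^ 3"
      by (simp add: e(4) psi_eq power2_eq_square power3_eq_cube mult_ac)
    finally show "dcong (of_nat p) ((of_nat q * J) ^ n * J) (chi (int p))" by (simp add: c3)
  }
qed

text \<open>The two residue classes of \<open>p\<close> modulo 3 lead to
  \<open>chi (int p) * J\<close> and to its conjugate respectively; adding the conjugate congruence
  gives the same trace.\<close>

lemma J_odd_power_cong:
  assumes "prime p" "p \<noteq> q" "p \<noteq> 3"
  defines "n \<equiv> p div 3"
  shows "dcong (of_nat p) (J ^ (2 * n + 1) + eis_cnj J ^ (2 * n + 1))
           (of_int (int q ^ n * eis_trace (chi (int p) * J)))"
proof -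
  let ?X = "chi (int p)"
  have "\<not> 3 dvd p" using assms(1,3) using primes_dvd_imp_eq[of 3 p] by auto
  hence p: "p = 3 * n + 1 \<or> p = 3 * n + 2" unfolding n_def by presburger
  have np: "\<not> int q dvd int p" using assms(1,2) prime_q by (metis int_dvd_int_iff primes_dvd_imp_eq)
  have X3: "?X ^ 3 = 1" using np by (rule chi_cube)
  have "\<not> p dvd q" using assms(1,2) prime_q by (metis primes_dvd_imp_eq)
  hence "[q ^ (p - 1) = 1] (mod p)" using assms(1) by (intro fermat_theorem)
  hence "[int q ^ (p - 1) = 1] (mod int p)" by (metis cong_int_iff of_nat_1 of_nat_power)
  hence "of_nat p dvd (of_nat q ^ (p - 1) - 1 :: eisenstein)"
    using eisenstein_of_int[of "int q ^ (p - 1)"]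
    unfolding eisenstein_of_nat_dvd_iff by (simp add: cong_iff_dvd_diff)
  hence fermat: "dcong (of_nat p) (of_nat q ^ (p - 1)) (1 :: eisenstein)" by (simp add: dcong_def)
  have cnj: "dcong (of_nat p) (eis_cnj x) (eis_cnj y)" if "dcong (of_nat p) x y" for x y
    using that unfolding dcong_def dvd_def by (metis eis_cnj_simps(4-6))
  have "dcong (of_nat p) (J ^ (2 * n + 1)) (of_nat q ^ n * (?X * J)) \<or>
        dcong (of_nat p) (J ^ (2 * n + 1)) (of_nat q ^ n * eis_cnj (?X * J))"
    using p
  proof
    assume p: "p = 3 * n + 1"
    \<comment> \<open>Squaring and multiplying by \<open>q ^ n * J\<close> produces
      \<open>q ^ (3 * n)\<close>, which is \<open>q ^ (p - 1)\<close> and is removed by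
      Fermat.\<close>
    have "dcong (of_nat p) (((of_nat q * J) ^ n) ^ 2 * (of_nat q ^ n * J)) ((?X ^ 2) ^ 2 * (of_nat q ^ n * J))"
      by (intro dcong_mult dcong_power J_power_cong assms p dcong_refl)
    moreover have "((of_nat q * J) ^ n) ^ 2 * (of_nat q ^ n * J) = of_nat q ^ (p - 1) * J ^ (2 * n + 1)"
    proof -
      have "p - 1 = n + n + n" "2 * n + 1 = n + n + 1" using p by simp_all
      thus ?thesis by (simp only: power_add power_one_right power_mult_distrib power2_eq_square mult_ac)
    qed
    moreover have "(?X ^ 2) ^ 2 * (of_nat q ^ n * J) = ?X ^ 3 * (of_nat q ^ n * (?X * J))"
      by (simp add: power2_eq_square power3_eq_cube mult_ac)
    moreover have "dcong (of_nat p) (of_nat q ^ (p - 1) * J ^ (2 * n + 1)) (1 * J ^ (2 * n + 1))"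
      by (intro dcong_mult fermat dcong_refl)
    ultimately show ?thesis using X3 by (metis dcong_sym dcong_trans mult_1)
  next
    assume p: "p = 3 * n + 2"
    \<comment> \<open>Now \<open>p - 1 = 3 * n + 1\<close>, and the square has one factor
      \<open>J\<close> to spare; together with \<open>eis_cnj J\<close> it supplies the missing
      factor \<open>q\<close>.\<close>
    have "dcong (of_nat p) (((of_nat q * J) ^ n * J) ^ 2 * (of_nat q ^ n * eis_cnj J)) (?X ^ 2 * (of_nat q ^ n * eis_cnj J))"
      by (intro dcong_mult dcong_power J_power_cong assms p dcong_refl)
    moreover have "((of_nat q * J) ^ n * J) ^ 2 * (of_nat q ^ n * eis_cnj J) = of_nat q ^ (p - 1) * J ^ (2 * n + 1)"
    proof -
      have "p - 1 = n + n + n + 1" "2 * n + 1 = n + n + 1" using p by simp_all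
      hence "of_nat q ^ (p - 1) = of_nat q ^ n * of_nat q ^ n * of_nat q ^ n * (J * eis_cnj J)"
        and "J ^ (2 * n + 1) = J ^ n * J ^ n * J"
        by (simp_all only: power_add power_one_right J_norm)
      thus ?thesis by (simp only: power_mult_distrib power2_eq_square mult_ac)
    qed
    moreover have "?X ^ 2 * (of_nat q ^ n * eis_cnj J) = of_nat q ^ n * eis_cnj (?X * J)"
      by (simp add: psi_eq[symmetric] psi_def mult_ac)
    moreover have "dcong (of_nat p) (of_nat q ^ (p - 1) * J ^ (2 * n + 1)) (1 * J ^ (2 * n + 1))"
      by (intro dcong_mult fermat dcong_refl)
    ultimately show ?thesis by (metis dcong_sym dcong_trans mult_1)
  qed
  moreover have "eis_cnj (eis_cnj z) = z" for z
    by (rule eisenstein.expand) (simp add: eis_cnj_def)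
  ultimately show ?thesis
  proof (elim disjE)
    assume *: "dcong (of_nat p) (J ^ (2 * n + 1)) (of_nat q ^ n * (?X * J))"
    show ?thesis using dcong_add[OF * cnj[OF *]]
      by (simp add: of_int_eis_trace distrib_left)
  next
    assume *: "dcong (of_nat p) (J ^ (2 * n + 1)) (of_nat q ^ n * eis_cnj (?X * J))"
      and "\<And>z. eis_cnj (eis_cnj z) = z"
    thus ?thesis using dcong_add[OF * cnj[OF *]]
      by (simp add: of_int_eis_trace distrib_left add.commute)
  qed
qed

text \<open>The representation \<open>4 * q = L ^ 2 + 27 * M ^ 2\<close> is unique up to signs. The
  sign of \<open>L\<close> is fixed modulo 3, and that of \<open>M\<close> by \<open>red_J\<close>
  and the choice of \<open>w\<close>.\<close>

lemma J_eqI: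
  assumes LM: "4 * int q = L ^ 2 + 27 * M ^ 2" and L3: "[L = 1] (mod 3)"
    and Lw: "[2 * L * w = 9 * M - L] (mod int q)"
  shows "eis_trace J = L" "om_part J = 3 * M"
proof -
  obtain M' where M': "om_part J = 3 * M'" using J_mod_3(2) by auto
  define L' where "L' = eis_trace J"
  have re: "2 * re_part J = L' + 3 * M'" by (simp add: L'_def eis_trace_def M')
  have "re_part (J * eis_cnj J) = int q" by (simp add: J_norm)
  hence norm: "re_part J * (re_part J - 3 * M') + 9 * M' ^ 2 = int q"
    by (simp add: eis_cnj_def M' power2_eq_square)
  have LM': "4 * int q = L' ^ 2 + 27 * M' ^ 2"
  proof -
    have "4 * int q = (2 * re_part J) * (2 * re_part J - 6 * M') + 36 * M' ^ 2"
      unfolding norm[symmetric] by (simp add: algebra_simps)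
    thus ?thesis unfolding re by (simp add: algebra_simps power2_eq_square)
  qed
  have "int q dvd L * L' + 27 * M * M'"
  proof -
    have "[2 * L * red J = 2 * L * 0] (mod int q)" by (intro cong_mult cong_refl red_J)
    moreover have "2 * L * red J = L * (2 * re_part J) + (2 * L * w) * (3 * M')"
      by (simp add: red_def M' algebra_simps)
    moreover have "[L * (2 * re_part J) + (2 * L * w) * (3 * M')
        = L * (2 * re_part J) + (9 * M - L) * (3 * M')] (mod int q)"
      by (intro cong_add cong_mult cong_refl Lw)
    moreover have "L * (2 * re_part J) + (9 * M - L) * (3 * M') = L * L' + 27 * M * M'"
      unfolding re by (simp add: algebra_simps)
    ultimately show ?thesis by (metis cong_0_iff cong_sym cong_trans mult_zero_right)
  qed
  then obtain r where r: "L * L' + 27 * M * M' = int q * r" by auto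
  \<comment> \<open>\<open>q\<close> divides the first square below, hence \<open>d\<close>, and \<open>27 * d\<^sup>2 \<le> 16 * q\<^sup>2\<close> leaves only \<open>d = 0\<close>.\<close>
  have sq: "(L * L' + 27 * M * M') ^ 2 + 27 * (L * M' - L' * M) ^ 2 = 16 * int q ^ 2"
  proof -
    have "(L * L' + 27 * M * M') ^ 2 + 27 * (L * M' - L' * M) ^ 2 = (L ^ 2 + 27 * M ^ 2) * (L' ^ 2 + 27 * M' ^ 2)"
      by (simp add: algebra_simps power2_eq_square)
    thus ?thesis unfolding LM[symmetric] LM'[symmetric] by (simp add: power2_eq_square)
  qed
  define d where "d = L * M' - L' * M"
  have d: "27 * d ^ 2 = int q ^ 2 * (16 - r ^ 2)"
    using sq unfolding r d_def by (simp add: algebra_simps power2_eq_square)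
  have "int q dvd 3 ^ 3 * d ^ 2" using d by simp
  hence "int q dvd d" using prime_int_q not_dvd_3 by (metis prime_dvd_mult_iff prime_dvd_power)
  then obtain e where e: "d = int q * e" by auto
  have "int q ^ 2 * (27 * e ^ 2) = int q ^ 2 * (16 - r ^ 2)"
    using d by (simp add: e power_mult_distrib)
  hence er: "27 * e ^ 2 = 16 - r ^ 2" using q_gt by simp
  hence "27 * e ^ 2 \<le> 16" by simp
  hence "e ^ 2 < 1" by linarith
  hence e0: "e = 0" by (metis int_one_le_iff_zero_less linorder_not_less zero_less_power2)
  hence "r ^ 2 = 4 ^ 2" using er by simp
  hence r4: "r = 4 \<or> r = -4" by (metis power2_eq_iff)
  have d0: "L * M' = L' * M" using e0 e d_def by simp
  \<comment> \<open>As \<open>d = 0\<close>, the two pairs are proportional with ratio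
    \<open>r / 4\<close>, hence 1 or -1; residues modulo 3 then exclude -1.\<close>
  have "L' * (4 * int q) = L * (L * L' + 27 * M * M')"
    unfolding LM using d0 by (simp add: algebra_simps power2_eq_square)
  hence "int q * (4 * L') = int q * (L * r)" unfolding r by (simp add: mult_ac)
  hence LL: "4 * L' = L * r" using q_gt by simp
  have L1: "L mod 3 = 1" using L3 by (simp add: cong_def)
  have "L' mod 3 = 1" using J_mod_3(1) re by presburger
  moreover have "L' = L \<or> L' = - L" using r4 LL by auto
  ultimately have "L' = L" using L1 by presburger
  moreover have "L \<noteq> 0" using L1 by auto
  ultimately show "eis_trace J = L" "om_part J = 3 * M"
    using d0 by (simp_all add: L'_def M')
qed

end

subsection \<open>Congruences between rationals\<close>

text \<open>The reduced denominator divides every denominator of the same number.\<close>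

lemma local_ring_divideI:
  assumes "\<not> int l dvd b"
  shows "of_int a / of_int b \<in> local_ring l"
proof -
  obtain n d where nd: "quotient_of (of_int a / of_int b) = (n, d)" by (cases "quotient_of (of_int a / of_int b)")
  have d: "d > 0" "coprime n d" using nd quotient_of_denom_pos quotient_of_coprime by auto
  have "b \<noteq> 0" using assms by auto
  have "(of_int a / of_int b :: rat) = of_int n / of_int d" using nd by (rule quotient_of_div)
  hence "of_int (a * d) = (of_int (n * b) :: rat)" using d \<open>b \<noteq> 0\<close> by (simp add: field_simps)
  hence "a * d = n * b" by (simp only: of_int_eq_iff)
  hence "d dvd n * b" by (metis dvd_triv_right)
  hence "d dvd b" using d by (simp add: coprime_commute coprime_dvd_mult_right_iff)
  thus ?thesis using assms nd by (auto simp: local_ring_def dest: dvd_trans)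
qed

text \<open>The bridge between the rational congruences of the theorem and the integer congruences
  proved above.\<close>

lemma rat_cong_divide_iff:
  assumes l: "prime l" and b: "\<not> int l dvd b" and d: "\<not> int l dvd d"
  shows "rat_cong (of_int a / of_int b) (of_int c / of_int d) l \<longleftrightarrow> [a * d = c * b] (mod int l)"
proof
  have nz: "b \<noteq> 0" "d \<noteq> 0" using b d by auto
  have pl: "prime (int l)" using l by simp
  assume "rat_cong (of_int a / of_int b) (of_int c / of_int d) l"
  then obtain x where x: "x \<in> local_ring l" "of_int a / of_int b - of_int c / of_int d = of_nat l * x"
    by (auto simp: rat_cong_def)
  obtain u v where uv: "quotient_of x = (u, v)" by (cases "quotient_of x")
  have v: "\<not> int l dvd v" using x(1) uv by (simp add: local_ring_def)
  have xuv: "x = of_int u / of_int v" "v > 0" using uv quotient_of_div quotient_of_denom_pos by auto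
  have "of_int ((a * d - c * b) * v) = (of_int (int l * (u * b * d)) :: rat)"
    using x(2) nz xuv(2) unfolding xuv(1) by (simp add: field_simps)
  hence "(a * d - c * b) * v = int l * (u * b * d)" by (simp only: of_int_eq_iff)
  hence "int l dvd (a * d - c * b) * v" by simp
  thus "[a * d = c * b] (mod int l)"
    using v pl by (simp add: prime_dvd_mult_iff cong_iff_dvd_diff)
next
  have nz: "b \<noteq> 0" "d \<noteq> 0" using b d by auto
  assume "[a * d = c * b] (mod int l)"
  then obtain k where k: "a * d - c * b = int l * k" by (auto simp: cong_iff_dvd_diff)
  have "(of_int (a * d - c * b) :: rat) = of_int (int l * k)" by (simp only: k)
  hence "of_int a / of_int b - of_int c / of_int d = of_nat l * (of_int k / of_int (b * d) :: rat)"
    using nz by (simp add: field_simps)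
  moreover have "\<not> int l dvd b * d" using l b d by (simp add: prime_dvd_mult_iff)
  ultimately show "rat_cong (of_int a / of_int b) (of_int c / of_int d) l"
    unfolding rat_cong_def using b d by (blast intro: local_ring_divideI)
qed

subsection \<open>The theorem\<close>

theorem theorem2p6:
  fixes p q :: nat and L M :: int
  assumes "prime q" and "\<exists>k. q = 3 * k + 1"
    and "4 * int q = L ^ 2 + 27 * M ^ 2" and "[L = 1] (mod 3)"
    and "prime p" and "p \<noteq> 2" and "p \<noteq> 3" and "p \<noteq> q" and "\<not> int p dvd L"
  defines "S \<equiv> (\<Sum>k = 1..p div 3. of_nat ((3 * k) choose k) * (of_int M ^ (2 * k) / of_nat q ^ k) :: rat)"
    and "t \<equiv> (9 * of_int M / of_int L :: rat)"
  shows "(rat_cong (of_nat p ^ ((q - 1) div 3)) 1 q \<longrightarrow> rat_cong S 0 p) \<and>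
    (rat_cong (of_nat p ^ ((q - 1) div 3)) ((- 1 + t) / 2) q \<longrightarrow> rat_cong S ((- 3 - t) / 2) p) \<and>
    (rat_cong (of_nat p ^ ((q - 1) div 3)) ((- 1 - t) / 2) q \<longrightarrow> rat_cong S ((- 3 + t) / 2) p)"
proof -
  note LM = assms(3)
  have prime_q: "prime (int q)" and prime_p: "prime (int p)" using assms(1,5) by simp_all
  have q3: "q mod 3 = 1" using assms(2) by presburger
  hence q_gt: "q > 2" using prime_ge_2_nat[OF assms(1)] by (cases "q = 2") auto
  have L0: "L \<noteq> 0" using assms(9) by auto
  \<comment> \<open>If \<open>q\<close> divided \<open>L\<close>, it would divide \<open>M\<close>
    as well, and then \<open>q ^ 2\<close> would divide \<open>4 * q\<close>.\<close>
  have q2L: "\<not> int q dvd 2 * L"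
  proof
    assume "int q dvd 2 * L"
    moreover have "\<not> int q dvd 2" using q_gt zdvd_imp_le[of "int q" 2] by auto
    ultimately have qL: "int q dvd L" using prime_q by (simp add: prime_dvd_mult_iff)
    have "int q dvd 3 ^ 3 * M ^ 2"
    proof -
      have "3 ^ 3 * M ^ 2 = 4 * int q - L * L" using LM by (simp add: power2_eq_square)
      thus ?thesis using qL by (metis dvd_diff dvd_mult dvd_refl)
    qed
    moreover have "\<not> int q dvd 3"
    proof
      assume "int q dvd 3"
      hence "q dvd 3" by presburger
      thus False using primes_dvd_imp_eq[of q 3] assms(1) q3 by auto
    qed
    ultimately have "int q dvd M" using prime_q by (metis prime_dvd_mult_iff prime_dvd_power)
    with qL obtain l m where lm: "L = int q * l" "M = int q * m" by (elim dvdE)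
    have "int q * 4 = int q * (int q * (l ^ 2 + 27 * m ^ 2))"
      using LM unfolding lm by (simp add: algebra_simps power2_eq_square)
    hence "int q dvd 4" using q_gt by (metis dvd_triv_left mult_cancel_left of_nat_0_eq_iff not_less_zero)
    moreover have "(4 :: int) = 2 * 2" by simp
    ultimately show False using prime_q \<open>\<not> int q dvd 2\<close> by (metis prime_dvd_mult_iff)
  qed
  obtain s where s: "[2 * L * s = 1] (mod int q)"
    using q2L prime_q by (metis coprime_commute coprime_iff_invertible_int prime_imp_coprime)
  \<comment> \<open>Modulo \<open>q\<close> this is \<open>(-1 + 9 * M / L) / 2\<close>, so that the
    second case of the theorem becomes \<open>chi (int p) = omega\<close>.\<close>
  define w where "w = s * (9 * M - L)"
  have Lw: "[2 * L * w = 9 * M - L] (mod int q)"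
    using cong_mult[OF s cong_refl[of "9 * M - L"]] by (simp add: w_def mult_ac)
  have "[w ^ 2 + w + 1 = 0] (mod int q)"
  proof -
    \<comment> \<open>Multiplied by \<open>(2 * L) ^ 2\<close>, the value becomes
      \<open>3 * (L ^ 2 + 27 * M ^ 2) = 12 * q\<close>.\<close>
    have "[(2 * L * w) ^ 2 + 2 * L * (2 * L * w) + (2 * L) ^ 2
        = (9 * M - L) ^ 2 + 2 * L * (9 * M - L) + (2 * L) ^ 2] (mod int q)"
      by (intro cong_add cong_mult cong_pow cong_refl Lw)
    moreover have "(9 * M - L) ^ 2 + 2 * L * (9 * M - L) + (2 * L) ^ 2 = 3 * (L ^ 2 + 27 * M ^ 2)"
      by (simp add: algebra_simps power2_eq_square)
    moreover have "(2 * L * w) ^ 2 + 2 * L * (2 * L * w) + (2 * L) ^ 2 = 2 * L * (2 * L) * (w ^ 2 + w + 1)"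
      by (simp add: algebra_simps power2_eq_square)
    ultimately have "int q dvd 2 * L * (2 * L) * (w ^ 2 + w + 1)"
      unfolding LM[symmetric] by (metis cong_dvd_iff dvd_mult dvd_triv_right)
    thus ?thesis using q2L prime_q by (metis cong_0_iff prime_dvd_mult_iff)
  qed
  then interpret cubic_character q w
    using assms(1) q3 by unfold_locales
  have trace: "eis_trace J = L" and om: "om_part J = 3 * M"
    using J_eqI[OF LM assms(4) Lw] by simp_all
  \<comment> \<open>Here \<open>J\<close> is \<open>(L + 3 * M) / 2 + 3 * M * omega\<close>;
    doubling avoids fractions.\<close>
  have tr: "eis_trace (1 * J) = L" "2 * eis_trace (omega * J) = - L - 9 * M"
    "2 * eis_trace (omega ^ 2 * J) = 9 * M - L"
    using trace om by (simp_all add: eis_trace_def power2_eq_square)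

  \<comment> \<open>The binomial sum and the trace\<close>
  define n where "n = p div 3"
  \<comment> \<open>\<open>Z\<close> is \<open>q ^ n * (S + 1)\<close>, the extra 1 being the term
    \<open>k = 0\<close>.\<close>
  define Z where "Z = (\<Sum>k\<le>n. int ((3 * k) choose k) * M ^ (2 * k) * int q ^ (n - k))"
  have "[L * Z = int q ^ n * eis_trace (chi (int p) * J)] (mod int p)"
  proof -
    define Y where "Y = (\<Sum>k\<le>n. int ((n + k) choose (2 * k)) * (-27 * M ^ 2) ^ k * int q ^ (n - k))"
    let ?Y = "\<Sum>k\<le>n. ((-27) ^ k * int ((n + k) choose (2 * k))) * M ^ (2 * k) * int q ^ (n - k)"
    have "[Z = ?Y] (mod int p)"
      unfolding Z_def n_def using assms(5,7) by (intro cong_sum cong_mult cong_refl choose_cong) auto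
    also have "?Y = Y"
      unfolding Y_def by (simp only: power_mult_distrib power_mult, simp only: mult_ac)
    finally have ZY: "[Z = Y] (mod int p)" .
    \<comment> \<open>These values turn \<open>Y\<close> into the sum of
      \<open>binomial_odd_power_sum\<close> at \<open>x = J\<close>,
      \<open>y = eis_cnj J\<close>.\<close>
    have sub: "(J - eis_cnj J) ^ 2 = of_int (-27 * M ^ 2)"
      by (rule eisenstein.expand) (simp add: eis_cnj_def om power2_eq_square)
    have add: "J + eis_cnj J = of_int L" by (simp add: trace flip: of_int_eis_trace)
    have "(J + eis_cnj J) * (\<Sum>k\<le>n. of_nat ((n + k) choose (2 * k)) * ((J - eis_cnj J) ^ 2) ^ k * (J * eis_cnj J) ^ (n - k))
        = J ^ (2 * n + 1) + eis_cnj J ^ (2 * n + 1)"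
      using binomial_odd_power_sum(1)[of J "eis_cnj J" n] by (simp only: power_mult)
    hence "of_int (L * Y) = J ^ (2 * n + 1) + eis_cnj J ^ (2 * n + 1)"
      unfolding sub add J_norm Y_def by simp
    hence "dcong (of_nat p) (of_int (L * Y)) (of_int (int q ^ n * eis_trace (chi (int p) * J)) :: eisenstein)"
      using J_odd_power_cong[OF assms(5,8,7)] by (simp only: n_def)
    hence "[L * Y = int q ^ n * eis_trace (chi (int p) * J)] (mod int p)"
      unfolding dcong_def eisenstein_of_nat_dvd_iff by (simp add: cong_iff_dvd_diff del: of_int_mult)
    thus ?thesis using cong_mult[OF cong_refl[of L] ZY] by (meson cong_trans)
  qed
  hence main: "[2 * L * Z = int q ^ n * (2 * eis_trace (chi (int p) * J))] (mod int p)"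
    using cong_mult[OF cong_refl[of 2]] by (fastforce simp: mult_ac)

  have S: "S = of_int (Z - int q ^ n) / of_int (int q ^ n)"
  proof -
    have "of_int Z = (\<Sum>k\<le>n. of_nat ((3 * k) choose k) * (of_int M ^ (2 * k) / of_nat q ^ k) * of_nat q ^ n :: rat)"
      unfolding Z_def of_int_sum
    proof (rule sum.cong[OF refl])
      fix k assume "k \<in> {..n}"
      hence "(of_nat q ^ (n - k) :: rat) = of_nat q ^ n / of_nat q ^ k"
        using q_gt by (simp add: power_diff)
      thus "of_int (int ((3 * k) choose k) * M ^ (2 * k) * int q ^ (n - k))
          = (of_nat ((3 * k) choose k) * (of_int M ^ (2 * k) / of_nat q ^ k) * of_nat q ^ n :: rat)"
        by simp
    qed
    also have "\<dots> = (1 + S) * of_nat q ^ n"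
    proof -
      have "{..n} = insert 0 {1..n}" by auto
      thus ?thesis unfolding S_def n_def[symmetric] sum_distrib_right[symmetric] by simp
    qed
    finally show ?thesis using q_gt by (simp add: field_simps)
  qed
  have pq: "\<not> int p dvd int q ^ n"
    using assms(1,5,8) primes_dvd_imp_eq[of p q] prime_p by (metis int_dvd_int_iff prime_dvd_power)
  have p2L: "\<not> int p dvd 2 * L"
  proof -
    have "\<not> p dvd 2" using assms(5,6) primes_dvd_imp_eq[of p 2] by auto
    hence "\<not> int p dvd 2" by presburger
    thus ?thesis using prime_p assms(9) by (simp add: prime_dvd_mult_iff)
  qed
  \<comment> \<open>By \<open>main\<close>, \<open>S + 1\<close> is congruent to
    \<open>c / (2 * L)\<close>.\<close>
  have S_cong: "rat_cong S (of_int (c - 2 * L) / of_int (2 * L)) p" if "2 * eis_trace (chi (int p) * J) = c" for c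
  proof -
    have "[2 * L * Z - 2 * L * int q ^ n = int q ^ n * c - 2 * L * int q ^ n] (mod int p)"
      using main that by (intro cong_diff cong_refl) simp
    hence "[(Z - int q ^ n) * (2 * L) = (c - 2 * L) * int q ^ n] (mod int p)"
      by (simp add: algebra_simps)
    thus ?thesis unfolding S using rat_cong_divide_iff[OF assms(5) pq p2L] by blast
  qed
  have P_cong: "[int p ^ m * d = c] (mod int q)"
    if "rat_cong (of_nat p ^ ((q - 1) div 3)) (of_int c / of_int d) q" "\<not> int q dvd d" for c d
    using rat_cong_divide_iff[OF assms(1) _ that(2), of 1 "int p ^ m" c] that(1) q_gt
    by (simp add: m_def zdvd1_eq)
  have chi_p: "chi (int p) = z" if "z \<in> units" "[2 * L * red z = int p ^ m * (2 * L)] (mod int q)" for z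
  proof (rule chi_eqI)
    show "\<not> int q dvd int p" using assms(1,5,8) by (metis int_dvd_int_iff primes_dvd_imp_eq)
    show "[red z = int p ^ m] (mod int q)"
      using that(2) coprime_q[OF q2L] by (metis cong_mult_lcancel mult.commute)
  qed (fact that(1))
  \<comment> \<open>The common denominator \<open>2 * L\<close> is prime to both \<open>p\<close>
    and \<open>q\<close>, as \<open>rat_cong_divide_iff\<close> requires.\<close>
  have t: "(-1 + t) / 2 = of_int (9 * M - L) / of_int (2 * L)" "(-1 - t) / 2 = of_int (- L - 9 * M) / of_int (2 * L)"
    "(-3 - t) / 2 = of_int (- L - 9 * M - 2 * L) / of_int (2 * L)" "(-3 + t) / 2 = of_int (9 * M - L - 2 * L) / of_int (2 * L)"
    using L0 by (simp_all add: t_def field_simps)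
  show ?thesis
  proof (intro conjI impI)
    assume "rat_cong (of_nat p ^ ((q - 1) div 3)) 1 q"
    hence "[int p ^ m * 1 = 1] (mod int q)" using P_cong[of 1 1] q_gt by (simp add: zdvd1_eq)
    from cong_mult[OF cong_sym[OF this] cong_refl[of "2 * L"]] have "chi (int p) = 1"
      by (intro chi_p) (simp_all add: units_def)
    thus "rat_cong S 0 p" using S_cong[of "2 * L"] tr by simp
  next
    assume "rat_cong (of_nat p ^ ((q - 1) div 3)) ((-1 + t) / 2) q"
    hence "[int p ^ m * (2 * L) = 9 * M - L] (mod int q)" unfolding t using q2L by (rule P_cong)
    hence "chi (int p) = omega"
      using Lw by (intro chi_p) (auto simp: units_def cong_def)
    thus "rat_cong S ((-3 - t) / 2) p" unfolding t using S_cong tr by simp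
  next
    assume "rat_cong (of_nat p ^ ((q - 1) div 3)) ((-1 - t) / 2) q"
    hence "[int p ^ m * (2 * L) = - L - 9 * M] (mod int q)" unfolding t using q2L by (rule P_cong)
    moreover have "[2 * L * red (omega ^ 2) = - L - 9 * M] (mod int q)"
    proof -
      have "[- (2 * L) - 2 * L * w = - (2 * L) - (9 * M - L)] (mod int q)"
        by (intro cong_diff cong_refl Lw)
      thus ?thesis by (simp add: red_omega2 algebra_simps)
    qed
    ultimately have "chi (int p) = omega ^ 2"
      by (intro chi_p) (auto simp: units_def cong_def)
    thus "rat_cong S ((-3 + t) / 2) p" unfolding t using S_cong tr by simp
  qed
qed

end
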